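(* Let $\gamma\in(1,5/3]$. If $\nu$ is an entropy admissible Young measure, then the support of $\nu$ is either a single point of $H$ or a subset of the vacuum line $V$.
   Context: Constants: $\theta:=(\gamma-1)/2$, $\lambda:=(3-\gamma)/(2(\gamma-1))$. State space: points of $\mathbb R^2$ are written $\mathbf a=(\overline a,\underline a)$; $H:=\{\mathbf a\in\mathbb R^2:\overline a>\underline a\}$. $\bar C(H)$ is the ring of bounded $\varphi\in C(\bar H)$ that are constant on the diagonal $\{\overline a=\underline a\}$ and for which $\mathbf a\mapsto\lim_{s\to\infty}\varphi(s\mathbf a)$ belongs to $C(S^1\cap\bar H)$. $\bar{\mathcal H}$ is the compact metrizable compactification of $H$ with $\bar C(H)\cong C(\bar{\mathcal H})$. $V\subset\bar{\mathcal H}$ (the vacuum) is the compactification of the diagonal $\{\overline a=\underline a\}$ (its points are not distinguished by the topology), and $\mathcal H:=H\cup V$. On $H$ the topology is the Euclidean one. For $\mathbf a\in H$: $\rho(\mathbf a)=\big((\overline a-\underline a)/2\big)^{1/\theta}$, $u(\mathbf a)=(\overline a+\underline a)/2$, $W(\mathbf a):=1+\rho(\mathbf a)^{\gamma+1}$ ($\rho=0$ on $V$). For $s\in\mathbb R$, with $(b)_+:=\max\{b,0\}$, $$\chi(s|\mathbf a):=\big((\overline a-s)(s-\underline a)\big)_+^\lambda,\qquad\sigma(s|\mathbf a):=\Big(\theta s+(1-\theta)\tfrac{\overline a+\underline a}{2}\Big)\chi(s|\mathbf a),$$ both zero on $V$. Entropy admissible Young measure: a probability measure $\nu\in\mathrm{Prob}(\mathcal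 H)$ such that $\langle W\rangle<\infty$, where $\langle\varphi\rangle:=\int_{\mathcal H}\varphi(\mathbf a)\,\nu(d\mathbf a)$, and such that for almost every $(s,s')\in\mathbb R^2$ $$\langle\chi(s)\sigma(s')-\sigma(s)\chi(s')\rangle-\langle\chi(s)\rangle\langle\sigma(s')\rangle+\langle\sigma(s)\rangle\langle\chi(s')\rangle=0,$$ where $\chi(s)$ stands for $\mathbf a\mapsto\chi(s|\mathbf a)$, etc. *)

theory Defs
  imports "HOL-Probability.Probability"
begin

text \<open>A point of the plane is a pair \<open>(x, y)\<close>, with \<open>x\<close> the overlined and \<open>y\<close> the underlined
  coordinate of the source.\<close>

definition H :: "(real \<times> real) set" where
  "H = {(x, y). x > y}"

definition Hbar :: "(real \<times> real) set" where
  "Hbar = {(x, y). x \<ge> y}"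

definition diagonal :: "(real \<times> real) set" where
  "diagonal = {(x, y). x = y}"

text \<open>The radial limit is taken in \<open>C(S\<^sup>1 \<inter> Hbar)\<close>, that is, uniformly in the direction; the limit is
  then automatically continuous. With merely pointwise limits the ring would contain all bounded
  combinations of bumps placed along a curve that goes to infinity and meets every ray in a bounded
  set; it would not be separable, and the compactification below would not be metrizable.
  Functions are set to \<open>undefined\<close> off \<open>Hbar\<close>, so that each element of the ring is one HOL function.\<close>

definition barC :: "(real \<times> real \<Rightarrow> real) set" where
  "barC = {\<phi> \<in> extensional Hbar.
     continuous_on Hbar \<phi> \<and> bounded (\<phi> ` Hbar) \<and> \<phi> constant_on diagonal \<and>
     (\<exists>\<psi>. continuous_on (sphere 0 1 \<inter> Hbar) \<psi> \<and>
          uniform_limit (sphere 0 1 \<inter> Hbar) (\<lambda>s a. \<phi> (s *\<^sub>R a)) \<psi> at_top)}"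

text \<open>The compactification with \<open>C(cpt) \<cong> barC\<close> is realised in the usual way, as the closure of the
  image of \<open>H\<close> under evaluation in the product of copies of the real line indexed by \<open>barC\<close>.
  It is Hausdorff, so the mutually indistinguishable points of the vacuum become one point of it.\<close>

type_synonym cpt_point = "(real \<times> real \<Rightarrow> real) \<Rightarrow> real"

definition eval_pt :: "real \<times> real \<Rightarrow> cpt_point" where
  "eval_pt a = (\<lambda>\<phi>\<in>barC. \<phi> a)"

definition cpt :: "cpt_point topology" where
  "cpt = (let P = product_topology (\<lambda>_. euclideanreal) barC
          in subtopology P (P closure_of (eval_pt ` H)))"

definition vacuum :: "cpt_point set" where
  "vacuum = cpt closure_of (eval_pt ` diagonal)"

definition state_space :: "cpt_point topology" where
  "state_space = subtopology cpt (eval_pt ` H \<union> vacuum)"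

text \<open>The following facts confirm that points of \<open>H\<close> are distinguished from each other and from the
  vacuum, and that the vacuum is one nonempty class of indistinguishable points.\<close>

lemma bump_in_barC:
  assumes "a \<in> H"
  shows "(\<lambda>z\<in>Hbar. max 0 (1 - dist z a / ((fst a - snd a) / 2))) \<in> barC"
proof -
  define r where "r = (fst a - snd a) / 2"
  have r: "r > 0" using assms by (auto simp: H_def r_def)
  define f where "f = (\<lambda>z. max 0 (1 - dist z a / r))"
  have far: "f z = 0" if "dist z a \<ge> r" for z
    using that r by (simp add: f_def)
  have cont: "continuous_on Hbar f"
    unfolding f_def using r by (intro continuous_intros) auto
  have "bounded (f ` Hbar)"
    using r by (intro boundedI[of _ 1]) (auto simp: f_def)
  moreover have diag0: "f z = 0" if "z \<in> diagonal" for z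
  proof (rule far)
    have "fst a - fst z \<le> dist z a" "snd z - snd a \<le> dist z a"
      using dist_fst_le[of z a] dist_snd_le[of z a] by (auto simp: dist_real_def)
    moreover have "fst z = snd z" using that by (auto simp: diagonal_def)
    ultimately show "dist z a \<ge> r" by (simp add: r_def)
  qed
  have cone: "s *\<^sub>R z \<in> Hbar" if "z \<in> Hbar" "s \<ge> 0" for s z
    using that by (auto simp: Hbar_def mult_left_mono)
  have "uniform_limit (sphere 0 1 \<inter> Hbar) (\<lambda>s z. restrict f Hbar (s *\<^sub>R z)) (\<lambda>_. 0) at_top"
  proof (rule uniform_limitI)
    fix e :: real assume "e > 0"
    show "\<forall>\<^sub>F s in at_top. \<forall>z\<in>sphere 0 1 \<inter> Hbar. dist (restrict f Hbar (s *\<^sub>R z)) 0 < e"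
      using eventually_ge_at_top[of "r + norm a"]
    proof eventually_elim
      case (elim s)
      have s: "s \<ge> 0" using elim r norm_ge_zero[of a] by linarith
      have "f (s *\<^sub>R z) = 0" if "norm z = 1" for z
      proof (rule far)
        have "norm (s *\<^sub>R z) = s" using that s by simp
        then show "dist (s *\<^sub>R z) a \<ge> r"
          using elim norm_triangle_ineq2[of "s *\<^sub>R z" a] by (simp add: dist_norm)
      qed
      then show ?case using \<open>e > 0\<close> s by (auto simp: cone)
    qed
  qed
  then have "\<exists>\<psi>. continuous_on (sphere 0 1 \<inter> Hbar) \<psi> \<and>
      uniform_limit (sphere 0 1 \<inter> Hbar) (\<lambda>s z. restrict f Hbar (s *\<^sub>R z)) \<psi> at_top"
    by (intro exI[of _ "\<lambda>_. 0"]) simp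
  moreover have "restrict f Hbar constant_on diagonal"
    using diag0 by (auto simp: constant_on_def Hbar_def diagonal_def)
  moreover have "continuous_on Hbar (restrict f Hbar)"
    using cont by (simp cong: continuous_on_cong)
  ultimately have "restrict f Hbar \<in> barC"
    unfolding barC_def by simp
  then show ?thesis by (simp add: f_def r_def)
qed

lemma eval_pt_separates:
  assumes "a \<in> H" "b \<in> Hbar" "a \<noteq> b"
  shows "eval_pt a \<noteq> eval_pt b"
proof
  assume eq: "eval_pt a = eval_pt b"
  define f where "f = (\<lambda>z\<in>Hbar. max 0 (1 - dist z a / ((fst a - snd a) / 2)))"
  have "f \<in> barC" using bump_in_barC[OF assms(1)] by (simp add: f_def)
  then have "f a = f b" using fun_cong[OF eq, of f] by (simp add: eval_pt_def)
  moreover have "a \<in> Hbar" "fst a > snd a" using assms(1) by (auto simp: H_def Hbar_def)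
  moreover have "dist b a / ((fst a - snd a) / 2) > 0" using calculation assms(3) by simp
  ultimately show False using assms(2) unfolding f_def restrict_def by (simp del: zero_less_divide_iff zero_less_dist_iff)
qed

lemma inj_on_eval_pt: "inj_on eval_pt H"
proof (rule inj_onI)
  fix a b assume "a \<in> H" "b \<in> H" "eval_pt a = eval_pt b"
  moreover have "b \<in> Hbar" using \<open>b \<in> H\<close> by (auto simp: H_def Hbar_def)
  ultimately show "a = b" using eval_pt_separates by blast
qed

lemma vacuum_eq: "vacuum = {eval_pt (0, 0)}"
proof -
  define P where "P = product_topology (\<lambda>_::real \<times> real \<Rightarrow> real. euclideanreal) barC"
  have cpt: "cpt = subtopology P (P closure_of (eval_pt ` H))"
    by (simp add: cpt_def P_def Let_def)
  have haus: "Hausdorff_space cpt"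
    unfolding cpt P_def by (intro Hausdorff_space_subtopology) (simp add: Hausdorff_space_product_topology)
  have img: "eval_pt ` diagonal = {eval_pt (0, 0)}"
  proof -
    have "eval_pt d = eval_pt (0, 0)" if "d \<in> diagonal" for d
      using that unfolding eval_pt_def barC_def constant_on_def diagonal_def
      by (intro restrict_ext) fastforce
    moreover have "(0, 0) \<in> diagonal" by (simp add: diagonal_def)
    ultimately show ?thesis by (metis (no_types, lifting) image_cong image_constant)
  qed
  have "continuous_map (top_of_set Hbar) P eval_pt"
    unfolding P_def continuous_map_componentwise eval_pt_def barC_def by auto
  moreover have "(0, 0) \<in> top_of_set Hbar closure_of H"
  proof -
    have "((\<lambda>n. (inverse (real (Suc n)), 0::real)) \<longlonglongrightarrow> (0, 0))"
      by (intro tendsto_Pair LIMSEQ_inverse_real_of_nat tendsto_const)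
    then have "(0, 0) \<in> closure H"
      unfolding closure_sequential by (intro exI conjI) (auto simp: H_def)
    moreover have "H \<subseteq> Hbar" by (auto simp: H_def Hbar_def)
    ultimately show ?thesis
      by (simp add: closure_of_subtopology Int_absorb1 Hbar_def)
  qed
  ultimately have "eval_pt (0, 0) \<in> P closure_of (eval_pt ` H)"
    by (metis continuous_map_image_closure_subset image_subset_iff)
  then have "eval_pt (0, 0) \<in> topspace cpt"
    unfolding cpt using closure_of_subset_topspace by fastforce
  then have "cpt closure_of {eval_pt (0, 0)} = {eval_pt (0, 0)}"
    using haus by (simp add: closedin_Hausdorff_singleton closure_of_closedin)
  then show ?thesis by (simp add: vacuum_def img)
qed

lemma vacuum_disjoint: "eval_pt ` H \<inter> vacuum = {}"
  using eval_pt_separates[of _ "(0, 0)"] by (fastforce simp: vacuum_eq Hbar_def H_def)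

definition theta :: "real \<Rightarrow> real" where
  "theta \<gamma> = (\<gamma> - 1) / 2"

definition lam :: "real \<Rightarrow> real" where
  "lam \<gamma> = (3 - \<gamma>) / (2 * (\<gamma> - 1))"

text \<open>Functions given by a formula on \<open>H\<close>, transported to the state space and set to \<open>0\<close> on the
  vacuum.\<close>

definition on_states :: "(real \<times> real \<Rightarrow> real) \<Rightarrow> cpt_point \<Rightarrow> real" where
  "on_states f p = (if p \<in> eval_pt ` H then f (the_inv_into H eval_pt p) else 0)"

definition rho :: "real \<Rightarrow> cpt_point \<Rightarrow> real" where
  "rho \<gamma> = on_states (\<lambda>(x, y). ((x - y) / 2) powr (1 / theta \<gamma>))"

definition W :: "real \<Rightarrow> cpt_point \<Rightarrow> real" where
  "W \<gamma> p = 1 + rho \<gamma> p powr (\<gamma> + 1)"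

definition chi :: "real \<Rightarrow> real \<Rightarrow> cpt_point \<Rightarrow> real" where
  "chi \<gamma> s = on_states (\<lambda>(x, y). max ((x - s) * (s - y)) 0 powr lam \<gamma>)"

definition sigma_kernel :: "real \<Rightarrow> real \<Rightarrow> cpt_point \<Rightarrow> real" where
  "sigma_kernel \<gamma> s = on_states (\<lambda>(x, y).
     (theta \<gamma> * s + (1 - theta \<gamma>) * ((x + y) / 2)) * max ((x - s) * (s - y)) 0 powr lam \<gamma>)"

text \<open>All functions integrated below are dominated by a multiple of a power of \<open>W\<close> with exponent at most one,
  locally uniformly in \<open>s\<close> and \<open>s'\<close>; hence the finiteness of the integral of \<open>W\<close> makes the Bochner
  integrals genuine.\<close>

definition entropy_admissible :: "real \<Rightarrow> cpt_point measure \<Rightarrow> bool" where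
  "entropy_admissible \<gamma> \<nu> \<longleftrightarrow>
     prob_space \<nu> \<and>
     sets \<nu> = sets (sigma (topspace state_space) {U. openin state_space U}) \<and>
     (\<integral>\<^sup>+ p. ennreal (W \<gamma> p) \<partial>\<nu>) < \<infinity> \<and>
     (AE (s, s') in (lborel :: (real \<times> real) measure).
        (\<integral> p. chi \<gamma> s p * sigma_kernel \<gamma> s' p - sigma_kernel \<gamma> s p * chi \<gamma> s' p \<partial>\<nu>)
        - (\<integral> p. chi \<gamma> s p \<partial>\<nu>) * (\<integral> p. sigma_kernel \<gamma> s' p \<partial>\<nu>)
        + (\<integral> p. sigma_kernel \<gamma> s p \<partial>\<nu>) * (\<integral> p. chi \<gamma> s' p \<partial>\<nu>) = 0)"

definition measure_support :: "'a topology \<Rightarrow> 'a measure \<Rightarrow> 'a set" where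
  "measure_support X \<nu> = {x \<in> topspace X. \<forall>U. openin X U \<and> x \<in> U \<longrightarrow> emeasure \<nu> U > 0}"

end

theory Submission
  imports Defs
begin

text \<open>With \<open>f(s) = \<langle>\<chi>(s)\<rangle>\<close>, \<open>X(s) = \<chi>(s) / f(s)\<close> and \<open>m(s) = s + 2 \<lambda> \<langle>u \<chi>(s)\<rangle> / f(s)\<close>, the relation of the Young measure reads
  \<open>\<langle>X(s) X(t)\<rangle> = (m(s) - m(t)) / (s - t)\<close> on \<open>I = {f > 0}\<close>, which is an open interval. Thus the divided differences
  of \<open>m\<close> form a positive semidefinite kernel, and as in Loewner's theorem the functions \<open>s \<mapsto> \<langle>Y, X(s)\<rangle>\<close>
  have the unique continuation property of analytic functions on \<open>I\<close>. For \<open>p \<in> I\<close> let \<open>Y\<close> be the indicator of the states with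
  lower coordinate at least \<open>p\<close>: then \<open>\<langle>Y, X(s)\<rangle>\<close> vanishes for \<open>s \<le> p\<close>, hence for \<open>s > p\<close> as well. So almost every
  state in \<open>H\<close> has no coordinate in \<open>I\<close>, which leaves only the state whose interval is \<open>I\<close> itself; and
  the relation forces its mass to be one.\<close>

section \<open>Unique continuation for Loewner kernels\<close>

text \<open>The factor \<open>2 \<lambda>\<close> in \<open>m\<close> comes from
  \<open>1 - \<theta> = 2 \<lambda> \<theta>\<close>, which makes \<open>\<theta> * m(s)\<close> the
  quotient of the averages of \<open>\<sigma>(s)\<close> and \<open>\<chi>(s)\<close>. The averages
  are only known to be continuous, so unique continuation cannot start from power series; operator
  theory replaces them. Because the kernel consists of divided differences, the map
  \<open>X(i) \<mapsto> (X(i) - X(p)) / (i - p)\<close> is symmetric: its form is a second divided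
  difference. It behaves like the resolvent at \<open>p\<close> of a self-adjoint operator without
  spectrum in \<open>I\<close>, and its norm is at most \<open>1 / d\<close> whenever
  \<open>p\<close> is at distance \<open>d\<close> from points of \<open>I\<close> on both sides. On
  a function \<open>h\<close> that vanishes up to \<open>p\<close> it acts as division by
  \<open>s - p\<close>; dividing \<open>n\<close> times costs only \<open>d\<close> to the power
  \<open>-n\<close>, which forces \<open>h s = 0\<close> for \<open>s - p < d\<close>. No Hilbert
  space is built: everything is expressed by finite quadratic forms, and nodes at which a quotient
  is singular are reached by limits. The null set of each continuation depends on its parameters, so
  these are restricted to rationals before speaking of almost every state.\<close>

definition div_diff :: "(real \<Rightarrow> real) \<Rightarrow> (real \<Rightarrow> real) \<Rightarrow> real \<Rightarrow> real \<Rightarrow> real" where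
  "div_diff m g s t = (if s = t then g s else (m s - m t) / (s - t))"

definition qform :: "(real \<Rightarrow> real \<Rightarrow> real) \<Rightarrow> real set \<Rightarrow> (real \<Rightarrow> real) \<Rightarrow> (real \<Rightarrow> real) \<Rightarrow> real" where
  "qform K S c e = (\<Sum>i\<in>S. \<Sum>j\<in>S. c i * e j * K i j)"

definition loewner :: "real set \<Rightarrow> (real \<Rightarrow> real) \<Rightarrow> (real \<Rightarrow> real) \<Rightarrow> bool" where
  "loewner I m g \<longleftrightarrow> open I \<and> is_interval I \<and>
     (\<forall>s\<in>I. (m has_real_derivative g s) (at s)) \<and> continuous_on I g \<and>
     (\<forall>S c. finite S \<longrightarrow> S \<subseteq> I \<longrightarrow> 0 \<le> qform (div_diff m g) S c c)"

text \<open>The second divided difference of \<open>m\<close> at \<open>q\<close>, \<open>i\<close>,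
  \<open>j\<close>. The node \<open>i = q\<close> gives division by zero and is excluded wherever
  the value matters, whereas \<open>i = j\<close> is harmless.\<close>

definition div_diff2 :: "(real \<Rightarrow> real) \<Rightarrow> (real \<Rightarrow> real) \<Rightarrow> real \<Rightarrow> real \<Rightarrow> real \<Rightarrow> real" where
  "div_diff2 m g q i j = (div_diff m g i j - div_diff m g q j) / (i - q)"

section \<open>Symmetry, reflection and continuity of divided differences\<close>

lemma div_diff_sym: "div_diff m g s t = div_diff m g t s"
proof -
  have "(m s - m t) / (s - t) = (m t - m s) / (t - s)"
    by (simp add: divide_simps) (simp add: algebra_simps)?
  then show ?thesis by (simp add: div_diff_def)
qed

lemma div_diff_mult: "(s - t) * div_diff m g s t = m s - m t"
  by (simp add: div_diff_def)

lemma div_diff2_sym: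
  assumes "q \<noteq> i" "q \<noteq> j"
  shows "div_diff2 m g q i j = div_diff2 m g q j i"
proof -
  have mi: "m i = m j + (i - j) * div_diff m g i j" using div_diff_mult[of i j m g] by simp
  have *: "div_diff m g q j = (m q - m j) / (q - j)" "div_diff m g q i = (m q - m i) / (q - i)"
    using assms by (auto simp: div_diff_def)
  show ?thesis
    unfolding div_diff2_def div_diff_sym[of m g j i] * mi using assms by (simp add: divide_simps) (simp add: algebra_simps)
qed

lemma div_diff_reflect: "div_diff (\<lambda>s. - m (- s)) (\<lambda>s. g (- s)) = (\<lambda>s t. div_diff m g (- s) (- t))"
  unfolding div_diff_def by (auto intro!: ext simp: divide_simps) (simp add: algebra_simps)

lemma qform_reflect: "qform (\<lambda>i j. K (- i) (- j)) S c e = qform K (uminus ` S) (\<lambda>i. c (- i)) (\<lambda>i. e (- i))"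
  unfolding qform_def by (simp add: sum.reindex)

text \<open>Negating both argument and value keeps first divided differences. This turns upper
  bounds into lower bounds and continuation to the right into continuation to the left.\<close>

lemma loewner_reflect:
  assumes "loewner I m g"
  shows "loewner (uminus ` I) (\<lambda>s. - m (- s)) (\<lambda>s. g (- s))"
proof -
  have "open (uminus ` I)" using assms open_negations[of I] by (simp add: loewner_def)
  moreover have "is_interval (uminus ` I)" using assms by (simp add: loewner_def)
  moreover have "((\<lambda>s. - m (- s)) has_real_derivative g (- s)) (at s)" if "s \<in> uminus ` I" for s
  proof -
    have "(m has_real_derivative g (- s)) (at (- s))" using assms that by (auto simp: loewner_def)
    then have "((\<lambda>s. m (- s)) has_real_derivative g (- s) * (- 1)) (at s)"
      by (intro DERIV_chain2[of m] derivative_eq_intros) auto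
    then show ?thesis by (auto intro!: derivative_eq_intros)
  qed
  moreover have "continuous_on (uminus ` I) (\<lambda>s. g (- s))"
    using assms by (intro continuous_on_compose2[of I g _ uminus]) (auto simp: loewner_def intro!: continuous_intros)
  moreover have "0 \<le> qform (div_diff (\<lambda>s. - m (- s)) (\<lambda>s. g (- s))) S c c" if "finite S" "S \<subseteq> uminus ` I" for S c
  proof -
    have "uminus ` S \<subseteq> I" using that by auto
    then show ?thesis
      using assms that qform_reflect[of "div_diff m g" S c c] by (simp add: div_diff_reflect loewner_def)
  qed
  ultimately show ?thesis by (simp add: loewner_def)
qed

lemma div_diff_cont1:
  assumes L: "loewner I m g" and q: "q \<in> I" and i: "i \<in> I"
  shows "((\<lambda>q. div_diff m g q i) \<longlongrightarrow> div_diff m g q i) (at q)"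
proof (cases "q = i")
  case True
  have "((\<lambda>y. (m y - m i) / (y - i)) \<longlongrightarrow> g i) (at i)"
    using L i by (simp add: loewner_def has_field_derivative_iff)
  moreover have "\<forall>\<^sub>F y in at i. (m y - m i) / (y - i) = div_diff m g y i"
    by (simp add: div_diff_def eventually_at_filter)
  ultimately show ?thesis unfolding True by (simp add: tendsto_cong div_diff_def)
next
  case False
  have "isCont m q" using L q by (auto simp: loewner_def intro: DERIV_isCont)
  then have "((\<lambda>q. (m q - m i) / (q - i)) \<longlongrightarrow> (m q - m i) / (q - i)) (at q)"
    using False by (intro tendsto_intros) (auto simp: isCont_def)
  moreover have "\<forall>\<^sub>F y in at q. (m y - m i) / (y - i) = div_diff m g y i"
    using eventually_neq_at_within[of i q] by eventually_elim (simp add: div_diff_def)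
  ultimately show ?thesis using False by (simp add: tendsto_cong div_diff_def)
qed

lemma div_diff_cont2:
  assumes "loewner I m g" "q \<in> I" "i \<in> I"
  shows "((\<lambda>q. div_diff m g i q) \<longlongrightarrow> div_diff m g i q) (at q)"
proof -
  have "((\<lambda>q. div_diff m g q i) \<longlongrightarrow> div_diff m g i q) (at q)"
    using div_diff_cont1[OF assms] div_diff_sym[of m g q i] by simp
  then show ?thesis
    by (rule Lim_transform_eventually) (intro always_eventually allI div_diff_sym)
qed

lemma div_diff2_cont:
  assumes "loewner I m g" "q \<in> I" "j \<in> I" "i \<noteq> q"
  shows "((\<lambda>q. div_diff2 m g q i j) \<longlongrightarrow> div_diff2 m g q i j) (at q)"
  unfolding div_diff2_def
  by (rule tendsto_divide[OF tendsto_diff[OF tendsto_const div_diff_cont1[OF assms(1-3)]]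
        tendsto_diff[OF tendsto_const tendsto_ident_at]]) (use assms in auto)

text \<open>The symmetric quotient \<open>D t\<close> increases in \<open>t\<close> and tends to
  \<open>g x\<close> at \<open>0\<close>. Its derivative is
  \<open>(g (x + t) + g (x - t) - 2 * D t) / (2 * t)\<close>, and the numerator is the form on the
  nodes \<open>x - t\<close>, \<open>x + t\<close> with weights \<open>1\<close>,
  \<open>-1\<close>.\<close>

lemma div_diff_le_symmetric:
  assumes L: "loewner I m g" and e: "e > 0" and I: "{x - e..x + e} \<subseteq> I"
  shows "g x \<le> div_diff m g (x - e) (x + e)"
proof -
  define D where "D = (\<lambda>t. (m (x + t) - m (x - t)) / (2 * t))"
  have D_eq: "D t = div_diff m g (x - t) (x + t)" if "t > 0" for t
    using that unfolding D_def div_diff_def by (simp add: divide_simps)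
  have der: "\<exists>d. (D has_real_derivative d) (at t) \<and> 0 \<le> d" if t: "0 < t" "t < e" for t
  proof -
    have in_I: "x + t \<in> I" "x - t \<in> I" using t I by (auto simp: subset_iff)
    have d1: "((\<lambda>t. m (x + t)) has_real_derivative g (x + t) * 1) (at t)"
      by (rule DERIV_chain2[of m]) (use L in_I in \<open>auto simp: loewner_def intro!: derivative_eq_intros\<close>)
    have d2: "((\<lambda>t. m (x - t)) has_real_derivative g (x - t) * (- 1)) (at t)"
      by (rule DERIV_chain2[of m]) (use L in_I in \<open>auto simp: loewner_def intro!: derivative_eq_intros\<close>)
    have "(D has_real_derivative ((g (x + t) + g (x - t)) * (2 * t) - (m (x + t) - m (x - t)) * 2) / (2 * t * (2 * t))) (at t)"
      unfolding D_def using t by (auto intro!: derivative_eq_intros d1 d2)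
    moreover have "0 \<le> qform (div_diff m g) {x - t, x + t} (\<lambda>i. if i = x - t then 1 else - 1) (\<lambda>i. if i = x - t then 1 else - 1)"
      using L in_I by (auto simp: loewner_def)
    then have "0 \<le> g (x + t) + g (x - t) - 2 * D t"
      using t D_eq[of t] div_diff_sym[of m g "x - t" "x + t"] by (auto simp: qform_def) (simp add: div_diff_def)
    then have "0 \<le> (g (x + t) + g (x - t)) * (2 * t) - (m (x + t) - m (x - t)) * 2"
      using t unfolding D_def by (simp add: field_simps)
    ultimately show ?thesis using t by fastforce
  qed
  have mono: "D t \<le> D e'" if "0 < t" "t \<le> e'" "e' < e" for t e'
    by (rule DERIV_nonneg_imp_nondecreasing[OF that(2)]) (use der that in auto)
  have xI: "x \<in> I" using I e by (auto simp: subset_iff)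
  \<comment> \<open>The symmetric quotient is the mean of the two one-sided quotients, both of which
    tend to the derivative.\<close>
  have "((\<lambda>t. (div_diff m g (x + t) x + div_diff m g (x - t) x) / 2) \<longlongrightarrow> (div_diff m g x x + div_diff m g x x) / 2) (at_right 0)"
  proof (intro tendsto_intros)
    have lim: "((\<lambda>y. div_diff m g y x) \<longlongrightarrow> div_diff m g x x) (at x)" using div_diff_cont1[OF L xI xI] .
    have "filterlim (\<lambda>t. x + t) (at x) (at_right 0)" "filterlim (\<lambda>t. x - t) (at x) (at_right 0)"
      by (auto simp: filterlim_at eventually_at_filter intro!: tendsto_eq_intros)
    then show "((\<lambda>t. div_diff m g (x + t) x) \<longlongrightarrow> div_diff m g x x) (at_right 0)"
      "((\<lambda>t. div_diff m g (x - t) x) \<longlongrightarrow> div_diff m g x x) (at_right 0)"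
      using filterlim_compose[OF lim] by blast+
  qed auto
  moreover have "(div_diff m g (x + t) x + div_diff m g (x - t) x) / 2 = D t" if "t \<noteq> 0" for t
    using that unfolding div_diff_def D_def by (simp add: divide_simps)
  then have "\<forall>\<^sub>F t in at_right 0. (div_diff m g (x + t) x + div_diff m g (x - t) x) / 2 = D t"
    by (simp add: eventually_at_filter)
  ultimately have lim0: "(D \<longlongrightarrow> g x) (at_right 0)"
    by (simp add: tendsto_cong div_diff_def)
  have le: "g x \<le> D e'" if "0 < e'" "e' < e" for e'
  proof (rule tendsto_upperbound[OF lim0])
    show "\<forall>\<^sub>F t in at_right 0. D t \<le> D e'"
      using eventually_at_right_real[OF that(1)] by eventually_elim (use mono that in auto)
  qed simp
  have "isCont D e"
  proof -
    have m: "isCont m (x + e)" "isCont m (x - e)"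
      using L I e by (auto simp: loewner_def subset_iff intro!: DERIV_isCont)
    have "isCont (\<lambda>t. m (x + t)) e" by (rule isCont_o2[of e "\<lambda>t. x + t" m]) (use m in auto)
    moreover have "isCont (\<lambda>t. m (x - t)) e" by (rule isCont_o2[of e "\<lambda>t. x - t" m]) (use m in auto)
    ultimately show ?thesis
      unfolding D_def using e by (intro continuous_divide continuous_diff) auto
  qed
  then have "(D \<longlongrightarrow> D e) (at_left e)" by (simp add: isCont_def filterlim_at_split)
  then have "g x \<le> D e"
  proof (rule tendsto_lowerbound)
    show "\<forall>\<^sub>F t in at_left e. g x \<le> D t"
      using eventually_at_left_real[OF e] by eventually_elim (use le in auto)
  qed simp
  then show ?thesis using D_eq[OF e] by simp
qed

text \<open>Induction on the exceptional set: the interval is cut at \<open>x - e\<close> and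
  \<open>x + e\<close> around one exceptional point, the jump across it loses at most
  \<open>\<eta>\<close>, and \<open>\<eta>\<close> is arbitrary.\<close>

lemma le_across_finite_set:
  fixes F :: "real \<Rightarrow> real"
  assumes "finite S" "p \<le> b" "p \<notin> S" "b \<notin> S"
    and "\<And>q. p \<le> q \<Longrightarrow> q \<le> b \<Longrightarrow> q \<notin> S \<Longrightarrow> \<exists>d. (F has_real_derivative d) (at q) \<and> 0 \<le> d"
    and "\<And>x \<eta>. x \<in> S \<Longrightarrow> p < x \<Longrightarrow> x < b \<Longrightarrow> 0 < \<eta> \<Longrightarrow> \<forall>\<^sub>F e in at_right 0. F (x - e) - \<eta> \<le> F (x + e)"
  shows "F p \<le> F b"
  using assms
proof (induction S arbitrary: p b rule: finite_induct)
  case empty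
  show ?case by (rule DERIV_nonneg_imp_nondecreasing) (use empty in auto)
next
  case (insert x S)
  show ?case
  proof (cases "p < x \<and> x < b")
    case False
    then have "x < p \<or> b < x" using insert.prems(2,3) by auto
    then show ?thesis
      by (intro insert.IH) (use insert.prems in auto)
  next
    case True
    show ?thesis
    proof (rule field_le_epsilon)
      fix \<eta> :: real assume "0 < \<eta>"
      have "open (- S)" using insert.hyps(1) by (simp add: finite_imp_closed open_Compl)
      moreover have "((\<lambda>e. x - e) \<longlongrightarrow> x) (at_right 0)" "((\<lambda>e. x + e) \<longlongrightarrow> x) (at_right 0)"
        by (auto intro!: tendsto_eq_intros)
      \<comment> \<open>The cut points become endpoints in the induction hypothesis and so must
        avoid the remaining exceptional points.\<close>
      ultimately have notin: "\<forall>\<^sub>F e in at_right 0. x - e \<in> - S" "\<forall>\<^sub>F e in at_right 0. x + e \<in> - S"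
        using insert.hyps(2) by (metis ComplI topological_tendstoD)+
      have "\<forall>\<^sub>F e in at_right 0. F (x - e) - \<eta> \<le> F (x + e)"
        using insert.prems(5)[of x \<eta>] True \<open>0 < \<eta>\<close> by simp
      moreover have "\<forall>\<^sub>F e in at_right 0. e \<in> {0<..<min (x - p) (b - x)}"
        using True by (intro eventually_at_right_real) auto
      ultimately have "\<forall>\<^sub>F e in at_right (0::real). F p \<le> F b + \<eta>"
        using notin
      proof eventually_elim
        case (elim e)
        have "F p \<le> F (x - e)"
        proof (rule insert.IH)
          show "\<exists>d. (F has_real_derivative d) (at q) \<and> 0 \<le> d" if "p \<le> q" "q \<le> x - e" "q \<notin> S" for q
            using insert.prems(4)[of q] that elim by auto
          show "\<forall>\<^sub>F e in at_right 0. F (z - e) - \<eta> \<le> F (z + e)"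
            if "z \<in> S" "p < z" "z < x - e" "0 < \<eta>" for z \<eta>
            using insert.prems(5)[of z \<eta>] that elim by auto
        qed (use insert.prems elim in auto)
        moreover have "F (x + e) \<le> F b"
        proof (rule insert.IH)
          show "\<exists>d. (F has_real_derivative d) (at q) \<and> 0 \<le> d" if "x + e \<le> q" "q \<le> b" "q \<notin> S" for q
            using insert.prems(4)[of q] that elim by auto
          show "\<forall>\<^sub>F e in at_right 0. F (z - e) - \<eta> \<le> F (z + e)"
            if "z \<in> S" "x + e < z" "z < b" "0 < \<eta>" for z \<eta>
            using insert.prems(5)[of z \<eta>] that elim by auto
        qed (use insert.prems elim in auto)
        ultimately show ?case using elim by linarith
      qed
      then show "F p \<le> F b + \<eta>" by simp
    qed
  qed
qed

section \<open>The resolvent form and its Riccati monotonicity\<close>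

lemma qform_insert:
  assumes "finite S" "q \<notin> S"
  shows "qform K (insert q S) (a(q := x)) (e(q := y)) =
    qform K S a e + x * (\<Sum>j\<in>S. e j * K q j) + y * (\<Sum>i\<in>S. a i * K i q) + x * y * K q q"
proof -
  have "qform K (insert q S) (a(q := x)) (e(q := y)) =
     x * y * K q q + (\<Sum>j\<in>S. x * e j * K q j) + (\<Sum>i\<in>S. a i * y * K i q + (\<Sum>j\<in>S. a i * e j * K i j))"
    unfolding qform_def using assms
    by (simp add: sum.insert) (intro arg_cong2[where f="(+)"] sum.cong refl arg_cong2[where f="(*)"], auto)
  also have "\<dots> = qform K S a e + x * (\<Sum>j\<in>S. e j * K q j) + y * (\<Sum>i\<in>S. a i * K i q) + x * y * K q q"
    unfolding qform_def by (simp add: sum.distrib sum_distrib_left mult_ac)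
  finally show ?thesis .
qed

text \<open>This is the squared norm of the sum of \<open>a i * X i - \<alpha> i * X q\<close> over
  \<open>S\<close>: the node \<open>q\<close> collects all subtracted terms in the single weight
  \<open>- sum \<alpha> S\<close>.\<close>

lemma qform_insert_minus_sum:
  assumes "finite S" "q \<notin> S"
  shows "qform K (insert q S) (a(q := - sum \<alpha> S)) (a(q := - sum \<alpha> S)) =
    (\<Sum>i\<in>S. \<Sum>j\<in>S. a i * a j * K i j - a i * \<alpha> j * K i q - \<alpha> i * a j * K q j + \<alpha> i * \<alpha> j * K q q)"
proof -
  have 1: "(\<Sum>i\<in>S. \<Sum>j\<in>S. a i * \<alpha> j * K i q) = sum \<alpha> S * (\<Sum>i\<in>S. a i * K i q)"
    unfolding sum_product by (subst sum.swap) (simp add: mult_ac)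
  have 2: "(\<Sum>i\<in>S. \<Sum>j\<in>S. \<alpha> i * a j * K q j) = sum \<alpha> S * (\<Sum>j\<in>S. a j * K q j)"
    unfolding sum_product by (simp add: mult_ac)
  have 3: "(\<Sum>i\<in>S. \<Sum>j\<in>S. \<alpha> i * \<alpha> j * K q q) = sum \<alpha> S * sum \<alpha> S * K q q"
    by (simp only: sum_distrib_right[symmetric] sum_product[symmetric])
  show ?thesis
    unfolding qform_insert[OF assms] sum.distrib sum_subtractf 1 2 3 by (simp add: qform_def)
qed

text \<open>Write the kernel as \<open>\<langle>X i, X j\<rangle>\<close> and let \<open>R q\<close> send \<open>X i\<close> to \<open>(X i - X q) / (i - q)\<close>, a resolvent at \<open>q\<close> whose
  form is \<open>div_diff2\<close>. For a linear combination \<open>v\<close>, the function \<open>\<langle>R q v, v\<rangle>\<close> of \<open>q\<close> has the derivative \<open>\<parallel>R q v\<parallel>\<^sup>2\<close>,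
  and the increments of \<open>(b - q)\<^sup>2 \<langle>R q v, v\<rangle> + q \<parallel>v\<parallel>\<^sup>2\<close> are \<open>(q' - q) \<langle>Z q, Z q'\<rangle>\<close> with
  \<open>Z q = (b - q) R q v - v\<close>. Its monotonicity bounds \<open>\<langle>R p v, v\<rangle>\<close> by \<open>\<parallel>v\<parallel>\<^sup>2 / (b - p)\<close>.\<close>

definition riccati_incr :: "(real \<Rightarrow> real) \<Rightarrow> (real \<Rightarrow> real) \<Rightarrow> real \<Rightarrow> real \<Rightarrow> real \<Rightarrow> real \<Rightarrow> real \<Rightarrow> real" where
  "riccati_incr m g b q q' i j = ((b - i) * (b - j) * div_diff m g i j - (b - i) * (b - q') * div_diff m g i q'
     - (b - q) * (b - j) * div_diff m g q j + (b - q) * (b - q') * div_diff m g q q') / ((i - q) * (j - q'))"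

definition riccati :: "(real \<Rightarrow> real) \<Rightarrow> (real \<Rightarrow> real) \<Rightarrow> real \<Rightarrow> real \<Rightarrow> real \<Rightarrow> real \<Rightarrow> real" where
  "riccati m g b q i j = (b - q)\<^sup>2 * div_diff2 m g q i j + q * div_diff m g i j"

text \<open>The resolvent identity \<open>R q' - R q = (q' - q) * R q * R q'\<close> in matrix
  entries; both sides are the third divided difference of \<open>m\<close> at \<open>q\<close>,
  \<open>q'\<close>, \<open>i\<close>, \<open>j\<close>.\<close>

lemma div_diff2_diff:
  assumes "i \<noteq> q" "i \<noteq> q'" "j \<noteq> q" "j \<noteq> q'" "q \<noteq> q'"
  shows "(div_diff m g i j - div_diff m g i q' - div_diff m g q j + div_diff m g q q') / ((i - q) * (j - q')) =
    (div_diff2 m g q' i j - div_diff2 m g q i j) / (q' - q)"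
proof -
  have mi: "m i = m j + (i - j) * div_diff m g i j" using div_diff_mult[of i j m g] by simp
  have *: "div_diff m g q j = (m q - m j) / (q - j)" "div_diff m g q' j = (m q' - m j) / (q' - j)"
    "div_diff m g i q' = (m i - m q') / (i - q')" "div_diff m g q q' = (m q - m q') / (q - q')"
    using assms by (auto simp: div_diff_def)
  define x where "x = (div_diff m g i j)"
  define k where "k = m q - m j"
  define l where "l = m q' - m j"
  have **: "m j + (i - j) * x - m q' = (i - j) * x - l" "m q - m q' = k - l"
    by (auto simp: k_def l_def)
  show ?thesis
    unfolding div_diff2_def * mi x_def[symmetric] k_def[symmetric] l_def[symmetric] **
    using assms by (simp add: divide_simps) (simp add: algebra_simps)
qed

text \<open>\<open>riccati_incr\<close> is the pairing of \<open>Z q\<close> at \<open>X i\<close>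
  with \<open>Z q'\<close> at \<open>X j\<close>. Multiplying out gives one product of two
  resolvents, which the resolvent identity turns into a difference.\<close>

lemma riccati_diff:
  assumes "i \<noteq> q" "i \<noteq> q'" "j \<noteq> q" "j \<noteq> q'" "q \<noteq> q'"
  shows "riccati m g b q' i j - riccati m g b q i j = (q' - q) * riccati_incr m g b q q' i j"
proof -
  define R where "R = (div_diff m g i j - div_diff m g i q' - div_diff m g q j + div_diff m g q q') / ((i - q) * (j - q'))"
  have Rq: "(q' - q) * R = div_diff2 m g q' i j - div_diff2 m g q i j"
    unfolding R_def div_diff2_diff[OF assms] using assms by simp
  \<comment> \<open>Substitute \<open>b - i = (b - q) - (i - q)\<close> and
    \<open>b - j = (b - q') - (j - q')\<close>, so that each term can be divided by the denominator
    separately.\<close>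
  have num: "(b - i) * (b - j) * x - (b - i) * (b - q') * y - (b - q) * (b - j) * z + (b - q) * (b - q') * w =
     (b - q) * (b - q') * (x - y - z + w) - (b - q) * (j - q') * (x - z) - (b - q') * (i - q) * (x - y)
     + (i - q) * (j - q') * x" for x y z w
    by (simp add: algebra_simps)
  have split: "(c * X - \<beta> * v * z - \<beta>' * u * y + u * v * x) / (u * v) =
      c * (X / (u * v)) - \<beta> * (z / u) - \<beta>' * (y / v) + x" if "u \<noteq> 0" "v \<noteq> 0" for c X \<beta> \<beta>' u v x y z :: real
    using that by (simp add: add_divide_distrib diff_divide_distrib)
  have "riccati_incr m g b q q' i j = (b - q) * (b - q') * R - (b - q) * div_diff2 m g q i j - (b - q') * div_diff2 m g q' j i + div_diff m g i j"
    unfolding riccati_incr_def R_def div_diff2_def num div_diff_sym[of m g j i] div_diff_sym[of m g q' i]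
    by (rule split) (use assms in auto)
  then have Z: "riccati_incr m g b q q' i j = (b - q) * (b - q') * R - (b - q) * div_diff2 m g q i j - (b - q') * div_diff2 m g q' i j + div_diff m g i j"
    using div_diff2_sym[of q' j i] assms by simp
  have "(q' - q) * riccati_incr m g b q q' i j = (b - q) * (b - q') * ((q' - q) * R)
      - (q' - q) * (b - q) * div_diff2 m g q i j - (q' - q) * (b - q') * div_diff2 m g q' i j + (q' - q) * div_diff m g i j"
    unfolding Z by (simp add: algebra_simps)
  then show ?thesis
    unfolding Rq riccati_def by (simp add: algebra_simps power2_eq_square)
qed

text \<open>For \<open>q' = q\<close> the pairing is the squared norm of \<open>Z q v\<close>, a
  combination of the nodes in \<open>S\<close> and of \<open>q\<close>; \<open>a\<close> and
  \<open>\<alpha>\<close> are its weights.\<close>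

lemma riccati_incr_nonneg:
  assumes L: "loewner I m g" and S: "finite S" "S \<subseteq> I" and q: "q \<in> I" "q \<notin> S"
  shows "0 \<le> qform (riccati_incr m g b q q) S c c"
proof -
  define a where "a = (\<lambda>i. c i * (b - i) / (i - q))"
  define \<alpha> where "\<alpha> = (\<lambda>i. c i * (b - q) / (i - q))"
  have "qform (riccati_incr m g b q q) S c c = (\<Sum>i\<in>S. \<Sum>j\<in>S. a i * a j * div_diff m g i j - a i * \<alpha> j * div_diff m g i q
      - \<alpha> i * a j * div_diff m g q j + \<alpha> i * \<alpha> j * div_diff m g q q)"
    unfolding qform_def
  proof (intro sum.cong refl)
    fix i j assume "i \<in> S" "j \<in> S"
    then have "i \<noteq> q" "j \<noteq> q" using q by auto
    then show "c i * c j * riccati_incr m g b q q i j = a i * a j * div_diff m g i j - a i * \<alpha> j * div_diff m g i q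
      - \<alpha> i * a j * div_diff m g q j + \<alpha> i * \<alpha> j * div_diff m g q q"
      unfolding riccati_incr_def a_def \<alpha>_def by (simp add: divide_simps) (simp add: algebra_simps)
  qed
  also have "\<dots> = qform (div_diff m g) (insert q S) (a(q := - sum \<alpha> S)) (a(q := - sum \<alpha> S))"
    using qform_insert_minus_sum[OF S(1) q(2)] by simp
  also have "\<dots> \<ge> 0" using L S q by (simp add: loewner_def)
  finally show ?thesis .
qed

lemma riccati_deriv:
  assumes L: "loewner I m g" and S: "finite S" "S \<subseteq> I" and q: "q \<in> I" "q \<notin> S"
  shows "\<exists>d. ((\<lambda>q. qform (riccati m g b q) S c c) has_real_derivative d) (at q) \<and> 0 \<le> d"
proof (intro exI conjI)
  show "0 \<le> qform (riccati_incr m g b q q) S c c" by (rule riccati_incr_nonneg[OF assms])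
  have lim: "((\<lambda>q'. qform (riccati_incr m g b q q') S c c) \<longlongrightarrow> qform (riccati_incr m g b q q) S c c) (at q)"
    unfolding qform_def riccati_incr_def
  proof (intro tendsto_sum tendsto_mult tendsto_divide tendsto_diff tendsto_add tendsto_const tendsto_ident_at)
    fix i j assume "i \<in> S" "j \<in> S"
    then show "((\<lambda>q'. div_diff m g i q') \<longlongrightarrow> div_diff m g i q) (at q)"
      using div_diff_cont2[OF L q(1), of i] S by (simp add: subset_iff)
    show "(i - q) * (j - q) \<noteq> 0" using \<open>i \<in> S\<close> \<open>j \<in> S\<close> q by auto
  next
    show "((\<lambda>q'. div_diff m g q q') \<longlongrightarrow> div_diff m g q q) (at q)"
      by (rule div_diff_cont2[OF L q(1) q(1)])
  qed
  have "\<forall>\<^sub>F q' in at q. q' \<in> - S"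
    using S q by (intro topological_tendstoD[OF tendsto_ident_at]) (auto simp: finite_imp_closed open_Compl)
  moreover have "\<forall>\<^sub>F q' in at q. q' \<noteq> q" by (simp add: eventually_at_filter)
  ultimately have "\<forall>\<^sub>F q' in at q. qform (riccati_incr m g b q q') S c c
      = (qform (riccati m g b q') S c c - qform (riccati m g b q) S c c) / (q' - q)"
  proof eventually_elim
    case (elim q')
    have "(q' - q) * qform (riccati_incr m g b q q') S c c = qform (riccati m g b q') S c c - qform (riccati m g b q) S c c"
      unfolding qform_def sum_distrib_left sum_subtractf[symmetric]
    proof (intro sum.cong refl)
      fix i j assume "i \<in> S" "j \<in> S"
      then have "riccati m g b q' i j - riccati m g b q i j = (q' - q) * riccati_incr m g b q q' i j"
        using elim q by (intro riccati_diff) auto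
      then show "(q' - q) * (c i * c j * riccati_incr m g b q q' i j) = c i * c j * riccati m g b q' i j - c i * c j * riccati m g b q i j"
        unfolding right_diff_distrib[symmetric] by simp
    qed
    then have "(qform (riccati m g b q') S c c - qform (riccati m g b q) S c c) / (q' - q)
        = (q' - q) * qform (riccati_incr m g b q q') S c c / (q' - q)" by simp
    also have "\<dots> = qform (riccati_incr m g b q q') S c c" using elim by simp
    finally show ?case by simp
  qed
  then show "((\<lambda>q. qform (riccati m g b q) S c c) has_real_derivative qform (riccati_incr m g b q q) S c c) (at q)"
    using lim unfolding has_field_derivative_iff by (simp add: tendsto_cong)
qed

text \<open>By symmetry the second divided difference may be formed with denominator
  \<open>i - q\<close> or \<open>j - q\<close>, so the pole can pass \<open>x\<close> unless both
  indices are \<open>x\<close>.\<close>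

lemma riccati_lim:
  assumes L: "loewner I m g" and I: "x \<in> I" "i \<in> I" "j \<in> I" and ne: "i \<noteq> x \<or> j \<noteq> x"
  shows "\<exists>l. ((\<lambda>q. riccati m g b q i j) \<longlongrightarrow> l) (at x)"
proof -
  have "\<exists>l. ((\<lambda>q. div_diff2 m g q i j) \<longlongrightarrow> l) (at x)"
  proof (cases "i = x")
    case False
    then show ?thesis using div_diff2_cont[OF L I(1,3)] by blast
  next
    case True
    then have "((\<lambda>q. div_diff2 m g q j i) \<longlongrightarrow> div_diff2 m g x j i) (at x)"
      using div_diff2_cont[OF L I(1,2)] ne by blast
    moreover have "\<forall>\<^sub>F q in at x. div_diff2 m g q j i = div_diff2 m g q i j"
      using eventually_neq_at_within[of i x] eventually_neq_at_within[of j x]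
      by eventually_elim (use div_diff2_sym in metis)
    ultimately show ?thesis by (blast intro: Lim_transform_eventually)
  qed
  then obtain l where "((\<lambda>q. div_diff2 m g q i j) \<longlongrightarrow> l) (at x)" ..
  then have "((\<lambda>q. riccati m g b q i j) \<longlongrightarrow> (b - x)\<^sup>2 * l + x * div_diff m g i j) (at x)"
    unfolding riccati_def by (intro tendsto_intros)
  then show ?thesis ..
qed

lemma filterlim_shift_right:
  "filterlim (\<lambda>e. x + e) (at (x::real)) (at_right 0)" "filterlim (\<lambda>e. x - e) (at (x::real)) (at_right 0)"
  by (auto simp: filterlim_at eventually_at_filter intro!: tendsto_eq_intros)

text \<open>At a node \<open>x\<close> of \<open>v\<close> the form may jump, but only upwards, because
  \<open>g x \<le> div_diff m g (x - e) (x + e)\<close>.\<close>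

lemma riccati_jump_diag:
  assumes L: "loewner I m g" and x: "x \<in> I"
  shows "\<exists>l. (l \<longlongrightarrow> 0) (at_right 0) \<and> (\<forall>\<^sub>F e in at_right 0. l e \<le> riccati m g b (x + e) x x - riccati m g b (x - e) x x)"
proof -
  define P where "P = (\<lambda>e. div_diff m g (x + e) x - g x)"
  define Q where "Q = (\<lambda>e. div_diff m g (x - e) x - g x)"
  \<comment> \<open>The jump equals
    \<open>((b - x)\<^sup>2 + e\<^sup>2) * ((P e + Q e) / e) + l e\<close>. The first term may stay
    large but is nonnegative; \<open>l\<close> is the rest, which vanishes in the limit.\<close>
  define l where "l = (\<lambda>e. 2 * e * g x - 2 * (b - x) * (P e - Q e))"
  have lim: "((\<lambda>y. div_diff m g y x) \<longlongrightarrow> g x) (at x)" using div_diff_cont1[OF L x x] by (simp add: div_diff_def)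
  have "(P \<longlongrightarrow> g x - g x) (at_right 0)" "(Q \<longlongrightarrow> g x - g x) (at_right 0)"
    unfolding P_def Q_def
    by (intro tendsto_diff tendsto_const filterlim_compose[OF lim] filterlim_shift_right)+
  then have "(l \<longlongrightarrow> 2 * 0 * g x - 2 * (b - x) * ((g x - g x) - (g x - g x))) (at_right 0)"
    unfolding l_def by (intro tendsto_intros)
  then have "(l \<longlongrightarrow> 0) (at_right 0)" by simp
  moreover have "\<forall>\<^sub>F e in at_right 0. l e \<le> riccati m g b (x + e) x x - riccati m g b (x - e) x x"
  proof -
    obtain r where r: "r > 0" "cball x r \<subseteq> I"
      using L x open_contains_cball[of I] by (auto simp: loewner_def)
    have "\<forall>\<^sub>F e in at_right 0. e \<in> {0<..<r}" by (rule eventually_at_right_real[OF r(1)])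
    then show ?thesis
    proof eventually_elim
      case (elim e)
      then have e: "e > 0" "e < r" by auto
      have "{x - e..x + e} \<subseteq> cball x r" using e by (auto simp: dist_real_def)
      then have "g x \<le> div_diff m g (x - e) (x + e)"
        using r(2) by (intro div_diff_le_symmetric[OF L e(1)]) auto
      also have "div_diff m g (x - e) (x + e) = (div_diff m g (x + e) x + div_diff m g (x - e) x) / 2"
        using e by (simp add: div_diff_def divide_simps)
      finally have PQ: "0 \<le> P e + Q e" by (simp add: P_def Q_def)
      have "riccati m g b (x + e) x x = (b - x - e)\<^sup>2 * (P e / e) + (x + e) * g x"
        "riccati m g b (x - e) x x = (b - x + e)\<^sup>2 * (- Q e / e) + (x - e) * g x"
        unfolding riccati_def div_diff2_def P_def Q_def using e
        by (simp_all add: div_diff_def[of m g x x] minus_divide_left[symmetric] minus_diff_eq diff_diff_eq)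
          (simp_all add: divide_simps algebra_simps)
      then have "riccati m g b (x + e) x x - riccati m g b (x - e) x x = ((b - x)\<^sup>2 + e\<^sup>2) * ((P e + Q e) / e) + l e"
        using e by (simp add: l_def field_simps power2_eq_square)
      moreover have "0 \<le> ((b - x)\<^sup>2 + e\<^sup>2) * ((P e + Q e) / e)" using PQ e by simp
      ultimately show ?case by simp
    qed
  qed
  ultimately show ?thesis by blast
qed

text \<open>Only the entry with both indices \<open>x\<close> can jump. Its weight
  \<open>c x * c x\<close> is a square, so the sign of the diagonal jump survives the
  summation.\<close>

lemma riccati_jump:
  assumes L: "loewner I m g" and S: "finite S" "S \<subseteq> I" and x: "x \<in> S" and \<eta>: "0 < \<eta>"
  shows "\<forall>\<^sub>F e in at_right 0. qform (riccati m g b (x - e)) S c c - \<eta> \<le> qform (riccati m g b (x + e)) S c c"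
proof -
  have ex: "\<exists>l. (l \<longlongrightarrow> 0) (at_right 0) \<and>
      (\<forall>\<^sub>F e in at_right 0. l e \<le> c i * c j * (riccati m g b (x + e) i j - riccati m g b (x - e) i j))"
    if ij: "i \<in> S" "j \<in> S" for i j
  proof (cases "i = x \<and> j = x")
    case True
    obtain l where l: "(l \<longlongrightarrow> 0) (at_right 0)"
      "\<forall>\<^sub>F e in at_right 0. l e \<le> riccati m g b (x + e) x x - riccati m g b (x - e) x x"
      using riccati_jump_diag[OF L, of x b] x S by blast
    have "((\<lambda>e. c x * c x * l e) \<longlongrightarrow> c x * c x * 0) (at_right 0)" by (intro tendsto_intros l)
    moreover have "\<forall>\<^sub>F e in at_right 0. c x * c x * l e \<le> c x * c x * (riccati m g b (x + e) x x - riccati m g b (x - e) x x)"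
      using l(2) by eventually_elim (intro mult_left_mono, auto)
    ultimately show ?thesis using True by (intro exI[of _ "\<lambda>e. c x * c x * l e"]) simp
  next
    case False
    then obtain k where k: "((\<lambda>q. riccati m g b q i j) \<longlongrightarrow> k) (at x)"
      using riccati_lim[OF L, of x i j b] ij x S by blast
    have "((\<lambda>e. c i * c j * (riccati m g b (x + e) i j - riccati m g b (x - e) i j)) \<longlongrightarrow> c i * c j * (k - k)) (at_right 0)"
      by (intro tendsto_intros filterlim_compose[OF k] filterlim_shift_right)
    then show ?thesis
      by (intro exI[of _ "\<lambda>e. c i * c j * (riccati m g b (x + e) i j - riccati m g b (x - e) i j)"]) simp
  qed
  then have "\<exists>l. \<forall>z\<in>S \<times> S. (l z \<longlongrightarrow> 0) (at_right 0) \<and>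
      (\<forall>\<^sub>F e in at_right 0. l z e \<le> c (fst z) * c (snd z) * (riccati m g b (x + e) (fst z) (snd z) - riccati m g b (x - e) (fst z) (snd z)))"
    by (intro bchoice) auto
  then obtain l where l: "\<forall>z\<in>S \<times> S. (l z \<longlongrightarrow> 0) (at_right 0) \<and>
      (\<forall>\<^sub>F e in at_right 0. l z e \<le> c (fst z) * c (snd z) * (riccati m g b (x + e) (fst z) (snd z) - riccati m g b (x - e) (fst z) (snd z)))" ..
  have "((\<lambda>e. \<Sum>z\<in>S \<times> S. l z e) \<longlongrightarrow> (\<Sum>z\<in>S \<times> S. 0)) (at_right 0)" by (intro tendsto_sum bspec[OF l, THEN conjunct1])
  then have "\<forall>\<^sub>F e in at_right 0. - \<eta> < (\<Sum>z\<in>S \<times> S. l z e)"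
    using \<eta> by (intro order_tendstoD) auto
  moreover have "\<forall>\<^sub>F e in at_right 0. \<forall>z\<in>S \<times> S. l z e \<le> c (fst z) * c (snd z) * (riccati m g b (x + e) (fst z) (snd z) - riccati m g b (x - e) (fst z) (snd z))"
    by (intro eventually_ball_finite ballI bspec[OF l, THEN conjunct2] finite_cartesian_product S(1))
  ultimately show ?thesis
  proof eventually_elim
    case (elim e)
    have "(\<Sum>z\<in>S \<times> S. l z e) \<le> (\<Sum>z\<in>S \<times> S. c (fst z) * c (snd z) * (riccati m g b (x + e) (fst z) (snd z) - riccati m g b (x - e) (fst z) (snd z)))"
      by (intro sum_mono) (use elim(2) in blast)
    also have "\<dots> = qform (riccati m g b (x + e)) S c c - qform (riccati m g b (x - e)) S c c"
      unfolding qform_def sum.cartesian_product sum_subtractf[symmetric]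
      by (intro sum.cong) (auto simp: right_diff_distrib)
    finally show ?case using elim(1) by linarith
  qed
qed

text \<open>At the right endpoint of the comparison the factor \<open>(b - q)\<^sup>2\<close>
  removes the resolvent term and leaves \<open>b\<close> times the squared norm; monotonicity from
  \<open>p\<close> to there is the claim.\<close>

lemma div_diff2_upper:
  assumes L: "loewner I m g" and S: "finite S" "S \<subseteq> I" "p \<notin> S" and I: "p \<in> I" "b \<in> I" "p < b"
  shows "qform (div_diff2 m g p) S c c \<le> qform (div_diff m g) S c c / (b - p)"
proof -
  obtain r where r: "r > 0" "ball b r \<subseteq> I" using L I open_contains_ball[of I] by (auto simp: loewner_def)
  \<comment> \<open>\<open>b\<close> may be a node, but the comparison needs endpoints off
    \<open>S\<close>. A point slightly to the right will do, since it only makes the bound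
    smaller.\<close>
  have "infinite {b<..<b + r}" using r by simp
  then have "infinite ({b<..<b + r} - S)" using S by simp
  then obtain b' where b': "b < b'" "b' < b + r" "b' \<notin> S"
    by (metis DiffD1 DiffD2 finite.emptyI greaterThanLessThan_iff infinite_imp_nonempty ex_in_conv)
  have "b' \<in> I" using r b' by (auto simp: dist_real_def subset_iff)
  then have sub: "{p..b'} \<subseteq> I" using L I(1) mem_is_interval_1_I[of I p b']
    by (auto simp: loewner_def)
  define N where "N = qform (div_diff m g) S c c"
  have "qform (riccati m g b' p) S c c \<le> qform (riccati m g b' b') S c c"
  proof (rule le_across_finite_set[of S p b' "\<lambda>q. qform (riccati m g b' q) S c c"])
    show "\<exists>d. ((\<lambda>q. qform (riccati m g b' q) S c c) has_real_derivative d) (at q) \<and> 0 \<le> d"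
      if "p \<le> q" "q \<le> b'" "q \<notin> S" for q
      using that sub S by (intro riccati_deriv[OF L]) auto
  qed (use S I b' riccati_jump[OF L S(1,2)] in auto)
  moreover have "qform (riccati m g b' q) S c c = (b' - q)\<^sup>2 * qform (div_diff2 m g q) S c c + q * N" for q
    unfolding N_def qform_def riccati_def by (simp add: sum_distrib_left sum.distrib algebra_simps)
  ultimately have "(b' - p)\<^sup>2 * qform (div_diff2 m g p) S c c \<le> (b' - p) * N" by (simp add: algebra_simps)
  then have "qform (div_diff2 m g p) S c c \<le> N / (b' - p)"
    using I b' by (simp add: power2_eq_square mult.assoc pos_le_divide_eq mult.commute)
  also have "\<dots> \<le> N / (b - p)"
    using L S I b' by (intro divide_left_mono) (auto simp: N_def loewner_def)
  finally show ?thesis by (simp add: N_def)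
qed

lemma div_diff2_lower:
  assumes L: "loewner I m g" and S: "finite S" "S \<subseteq> I" "p \<notin> S" and I: "p \<in> I" "a \<in> I" "a < p"
  shows "- (qform (div_diff m g) S c c / (p - a)) \<le> qform (div_diff2 m g p) S c c"
proof -
  let ?m = "\<lambda>s. - m (- s)" and ?g = "\<lambda>s. g (- s)"
  let ?S = "uminus ` S" and ?c = "\<lambda>i. c (- i)"
  have "qform (div_diff2 ?m ?g (- p)) ?S ?c ?c \<le> qform (div_diff ?m ?g) ?S ?c ?c / (- a - (- p))"
    by (rule div_diff2_upper[OF loewner_reflect[OF L]]) (use S I in auto)
  moreover have "qform (div_diff ?m ?g) ?S ?c ?c = qform (div_diff m g) S c c"
    using qform_reflect[of "div_diff m g" ?S ?c ?c] unfolding div_diff_reflect by (simp add: image_image)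
  \<comment> \<open>Unlike first divided differences, second ones change sign under
    reflection.\<close>
  moreover have "div_diff2 ?m ?g (- p) = (\<lambda>i j. - div_diff2 m g p (- i) (- j))"
    unfolding div_diff2_def div_diff_reflect by (auto simp: fun_eq_iff divide_simps) (simp add: algebra_simps)
  then have "qform (div_diff2 ?m ?g (- p)) ?S ?c ?c = qform (\<lambda>i j. - div_diff2 m g p i j) S c c"
    using qform_reflect[of "\<lambda>i j. - div_diff2 m g p i j" ?S ?c ?c] by (simp add: image_image)
  moreover have "qform (\<lambda>i j. - div_diff2 m g p i j) S c c = - qform (div_diff2 m g p) S c c"
    by (simp add: qform_def sum_negf)
  ultimately show ?thesis by simp
qed

section \<open>Operator norm of the resolvent and unique continuation\<close>

lemma qform_add_scaled:
  assumes "\<And>i j. i \<in> S \<Longrightarrow> j \<in> S \<Longrightarrow> K i j = K j i"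
  shows "qform K S (\<lambda>i. c i + t * e i) (\<lambda>i. c i + t * e i) = qform K S c c + 2 * t * qform K S c e + t\<^sup>2 * qform K S e e"
proof -
  have "(\<Sum>i\<in>S. \<Sum>j\<in>S. e i * c j * K i j) = (\<Sum>i\<in>S. \<Sum>j\<in>S. c i * e j * K i j)"
    by (subst sum.swap) (intro sum.cong refl, simp add: assms)
  moreover have "qform K S (\<lambda>i. c i + t * e i) (\<lambda>i. c i + t * e i) = (\<Sum>i\<in>S. \<Sum>j\<in>S.
      c i * c j * K i j + t * (c i * e j * K i j) + t * (e i * c j * K i j) + t\<^sup>2 * (e i * e j * K i j))"
    unfolding qform_def by (intro sum.cong refl) (simp add: algebra_simps power2_eq_square)
  ultimately show ?thesis
    unfolding qform_def sum.distrib sum_distrib_left[symmetric] by simp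
qed

text \<open>A symmetric form bounded by \<open>C\<close> on the diagonal has operator norm at most
  \<open>C\<close>, by polarization at \<open>c + e / C\<close> and \<open>c - e / C\<close>. In
  this additive shape \<open>e\<close> can stand for an approximation of the image of
  \<open>c\<close>, and its norm term can be absorbed later.\<close>

lemma qform_polarize:
  assumes sym: "\<And>i j. i \<in> S \<Longrightarrow> j \<in> S \<Longrightarrow> K i j = K j i" "\<And>i j. i \<in> S \<Longrightarrow> j \<in> S \<Longrightarrow> T i j = T j i"
    and bound: "\<And>c. \<bar>qform T S c c\<bar> \<le> C * qform K S c c" and C: "C > 0"
  shows "2 * qform T S c e \<le> C\<^sup>2 * qform K S c c + qform K S e e"
proof -
  let ?p = "\<lambda>i. c i + 1 / C * e i" and ?n = "\<lambda>i. c i + (- 1 / C) * e i"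
  have "qform T S ?p ?p - qform T S ?n ?n \<le> C * qform K S ?p ?p + C * qform K S ?n ?n"
    using bound[of ?p] bound[of ?n] by linarith
  moreover have "qform T S ?p ?p - qform T S ?n ?n = 4 / C * qform T S c e"
    using qform_add_scaled[of S T c "1 / C" e] qform_add_scaled[of S T c "- 1 / C" e] sym(2)
    by simp
  moreover have "qform K S ?p ?p + qform K S ?n ?n = 2 * qform K S c c + 2 / C\<^sup>2 * qform K S e e"
    using qform_add_scaled[of S K c "1 / C" e] qform_add_scaled[of S K c "- 1 / C" e] sym(1)
    by (simp add: power_divide)
  ultimately have "4 / C * qform T S c e \<le> C * (2 * qform K S c c + 2 / C\<^sup>2 * qform K S e e)"
    by (simp only: distrib_left[symmetric])
  then have "C * (4 / C * qform T S c e) \<le> C * (C * (2 * qform K S c c + 2 / C\<^sup>2 * qform K S e e))"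
    using C by (intro mult_left_mono) auto
  moreover have "C * (4 / C * x) = 4 * x" "C * (C * (2 * y + 2 / C\<^sup>2 * z)) = 2 * C\<^sup>2 * y + 2 * z" for x y z
    using C by (simp_all add: field_simps power2_eq_square)
  ultimately show ?thesis by simp
qed

text \<open>The norm of \<open>R p v\<close>, where \<open>v = \<Sum>i\<in>S. c i * X i\<close>. As \<open>p\<close> is not an admissible node for \<open>div_diff2 m g p\<close>, the vector
  \<open>R p v\<close> is approximated by moving its node \<open>p\<close> to a nearby point \<open>q\<close>.\<close>

lemma resolvent_norm_bound:
  assumes L: "loewner I m g" and p: "p \<in> I" and S: "finite S" "S \<subseteq> I" "p \<notin> S" and C: "C > 0"
    and bound: "\<And>S c. finite S \<Longrightarrow> S \<subseteq> I \<Longrightarrow> p \<notin> S \<Longrightarrow> \<bar>qform (div_diff2 m g p) S c c\<bar> \<le> C * qform (div_diff m g) S c c"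
    and a: "\<And>i. a i = c i / (i - p)"
  shows "((\<lambda>q. qform (div_diff m g) (insert q S) (a(q := - sum a S)) (a(q := - sum a S))) \<longlongrightarrow>
      qform (div_diff m g) (insert p S) (a(p := - sum a S)) (a(p := - sum a S))) (at p)"
    and "qform (div_diff m g) (insert p S) (a(p := - sum a S)) (a(p := - sum a S)) \<le> C\<^sup>2 * qform (div_diff m g) S c c"
proof -
  define \<rho> where "\<rho> = qform (div_diff m g) (insert p S) (a(p := - sum a S)) (a(p := - sum a S))"
  \<comment> \<open>Let \<open>w q\<close> be the sum of \<open>a i * (X i - X q)\<close>, so that
    \<open>w p = R p v\<close>. Then \<open>N q\<close> is the squared norm of \<open>w q\<close>
    and \<open>T q\<close> its pairing with \<open>R p v\<close>; the weight \<open>0\<close> at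
    \<open>q\<close> leaves \<open>v\<close> unchanged on the larger node set.\<close>
  define N where "N = (\<lambda>q. qform (div_diff m g) (insert q S) (a(q := - sum a S)) (a(q := - sum a S)))"
  define T where "T = (\<lambda>q. qform (div_diff2 m g p) (insert q S) (c(q := 0)) (a(q := - sum a S)))"
  define K where "K = div_diff m g"
  have "((\<lambda>q. qform K S a a + - sum a S * (\<Sum>j\<in>S. a j * K q j) + - sum a S * (\<Sum>i\<in>S. a i * K i q) + - sum a S * - sum a S * g q) \<longlongrightarrow>
     qform K S a a + - sum a S * (\<Sum>j\<in>S. a j * K p j) + - sum a S * (\<Sum>i\<in>S. a i * K i p) + - sum a S * - sum a S * g p) (at p)"
    unfolding K_def
  proof (intro tendsto_add tendsto_mult tendsto_const tendsto_sum div_diff_cont1[OF L p] div_diff_cont2[OF L p])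
    have "continuous_on I g" "open I" using L by (auto simp: loewner_def)
    then show "(g \<longlongrightarrow> g p) (at p)"
      using p by (simp add: continuous_on_eq_continuous_at isCont_def)
  qed (use S in auto)
  moreover have "div_diff m g q q = g q" for q by (simp add: div_diff_def)
  ultimately have lim: "((\<lambda>q. qform K S a a + - sum a S * (\<Sum>j\<in>S. a j * K q j) + - sum a S * (\<Sum>i\<in>S. a i * K i q) + - sum a S * - sum a S * K q q) \<longlongrightarrow> \<rho>) (at p)"
    unfolding \<rho>_def qform_insert[OF S(1,3)] K_def by simp
  have evS: "\<forall>\<^sub>F q in at p. q \<in> - S"
    using S by (intro topological_tendstoD[OF tendsto_ident_at]) (auto simp: finite_imp_closed open_Compl)
  have evI: "\<forall>\<^sub>F q in at p. q \<in> I"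
    using L p by (intro topological_tendstoD[OF tendsto_ident_at]) (auto simp: loewner_def)
  have evp: "\<forall>\<^sub>F q in at p. q \<noteq> p" by (simp add: eventually_at_filter)
  have limN: "(N \<longlongrightarrow> \<rho>) (at p)"
    using lim
  proof (rule Lim_transform_eventually)
    show "\<forall>\<^sub>F q in at p. qform K S a a + - sum a S * (\<Sum>j\<in>S. a j * K q j) + - sum a S * (\<Sum>i\<in>S. a i * K i q) + - sum a S * - sum a S * K q q = N q"
      using evS unfolding N_def K_def by eventually_elim (subst qform_insert[OF S(1)], auto)
  qed
  then show "((\<lambda>q. qform (div_diff m g) (insert q S) (a(q := - sum a S)) (a(q := - sum a S))) \<longlongrightarrow>
      qform (div_diff m g) (insert p S) (a(p := - sum a S)) (a(p := - sum a S))) (at p)"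
    unfolding N_def \<rho>_def .
  have Ta: "c i * div_diff2 m g p i q = a i * (K i q - K p q)" if "i \<in> S" for i q
    unfolding div_diff2_def K_def a by simp
  have "((\<lambda>q. qform K S a a - (\<Sum>j\<in>S. sum a S * (a j * K p j)) + - sum a S * (\<Sum>i\<in>S. a i * (K i q - K p q))) \<longlongrightarrow>
     qform K S a a - (\<Sum>j\<in>S. sum a S * (a j * K p j)) + - sum a S * (\<Sum>i\<in>S. a i * (K i p - K p p))) (at p)"
    unfolding K_def
    by (intro tendsto_add tendsto_diff tendsto_mult tendsto_const tendsto_sum div_diff_cont2[OF L p]) (use S p in auto)
  also have "qform K S a a - (\<Sum>j\<in>S. sum a S * (a j * K p j)) + - sum a S * (\<Sum>i\<in>S. a i * (K i p - K p p)) = \<rho>"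
    unfolding \<rho>_def qform_insert[OF S(1,3)] K_def
    by (simp add: right_diff_distrib sum_subtractf sum_distrib_left[symmetric] sum_distrib_right[symmetric])
  finally have lim': "((\<lambda>q. qform K S a a - (\<Sum>j\<in>S. sum a S * (a j * K p j)) + - sum a S * (\<Sum>i\<in>S. a i * (K i q - K p q))) \<longlongrightarrow> \<rho>) (at p)" .
  have Tq: "T q = qform K S a a - (\<Sum>j\<in>S. sum a S * (a j * K p j)) + - sum a S * (\<Sum>i\<in>S. a i * (K i q - K p q))" if "q \<notin> S" for q
  proof -
    have "qform (div_diff2 m g p) S c a = (\<Sum>i\<in>S. \<Sum>j\<in>S. a i * a j * K i j - a i * (a j * K p j))"
      unfolding qform_def
    proof (intro sum.cong refl)
      fix i j assume "i \<in> S"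
      have "c i * a j * div_diff2 m g p i j = a j * (c i * div_diff2 m g p i j)" by simp
      also have "\<dots> = a j * (a i * (K i j - K p j))" using Ta[OF \<open>i \<in> S\<close>] by simp
      finally show "c i * a j * div_diff2 m g p i j = a i * a j * K i j - a i * (a j * K p j)"
        by (simp add: algebra_simps)
    qed
    also have "\<dots> = qform K S a a - (\<Sum>j\<in>S. sum a S * (a j * K p j))"
      unfolding sum_subtractf qform_def
      by (simp only: sum_distrib_left[symmetric] sum_distrib_right[symmetric])
    moreover have "(\<Sum>i\<in>S. c i * div_diff2 m g p i q) = (\<Sum>i\<in>S. a i * (K i q - K p q))"
      using Ta by (intro sum.cong) auto
    ultimately show ?thesis
      unfolding T_def qform_insert[OF S(1) that] by simp
  qed
  have limT: "(T \<longlongrightarrow> \<rho>) (at p)"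
    using lim'
  proof (rule Lim_transform_eventually)
    show "\<forall>\<^sub>F q in at p. qform K S a a - (\<Sum>j\<in>S. sum a S * (a j * K p j)) + - sum a S * (\<Sum>i\<in>S. a i * (K i q - K p q)) = T q"
      using evS by eventually_elim (use Tq in auto)
  qed
  have "\<forall>\<^sub>F q in at p. 2 * T q \<le> C\<^sup>2 * qform (div_diff m g) S c c + N q"
    using evS evI evp
  proof eventually_elim
    case (elim q)
    have "2 * T q \<le> C\<^sup>2 * qform (div_diff m g) (insert q S) (c(q := 0)) (c(q := 0)) + N q"
      unfolding T_def N_def
    proof (rule qform_polarize[OF div_diff_sym _ _ C])
      show "div_diff2 m g p i j = div_diff2 m g p j i" if "i \<in> insert q S" "j \<in> insert q S" for i j
        using that elim S by (intro div_diff2_sym) auto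
      show "\<bar>qform (div_diff2 m g p) (insert q S) c c\<bar> \<le> C * qform (div_diff m g) (insert q S) c c" for c
        using elim S by (intro bound) auto
    qed
    moreover have "qform (div_diff m g) (insert q S) (c(q := 0)) (c(q := 0)) = qform (div_diff m g) S c c"
      using elim by (subst qform_insert[OF S(1)]) auto
    ultimately show ?case by simp
  qed
  \<comment> \<open>Both \<open>N\<close> and \<open>T\<close> tend to \<open>\<rho>\<close>, so one
    of the two copies cancels.\<close>
  then have "2 * \<rho> \<le> C\<^sup>2 * qform (div_diff m g) S c c + \<rho>"
    by (intro tendsto_le[OF _ tendsto_add[OF tendsto_const limN] tendsto_mult[OF tendsto_const limT]]) auto
  then show "qform (div_diff m g) (insert p S) (a(p := - sum a S)) (a(p := - sum a S)) \<le> C\<^sup>2 * qform (div_diff m g) S c c"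
    by (simp add: \<rho>_def)
qed

text \<open>If \<open>h s = \<langle>Y, X s\<rangle>\<close> vanishes up to \<open>p\<close>, then \<open>h s / (s - p)\<close> arises from \<open>\<langle>Y, R p _\<rangle>\<close>, so that
  \<open>h s / (s - p) ^ n\<close> is bounded by a multiple of \<open>1 / d ^ n\<close>, where \<open>d\<close> is the distance from \<open>p\<close> to the ends \<open>a\<close>, \<open>b\<close>.\<close>

lemma unique_continuation_right:
  assumes L: "loewner I m g" and I: "a \<in> I" "b \<in> I" "a < p" "p < b"
    and h: "\<And>S c. finite S \<Longrightarrow> S \<subseteq> I \<Longrightarrow> (\<Sum>i\<in>S. c i * h i)\<^sup>2 \<le> qform (div_diff m g) S c c"
    and zero: "\<And>q. q \<in> I \<Longrightarrow> q \<le> p \<Longrightarrow> h q = 0"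
    and s: "p < s" "s < p + min (p - a) (b - p)"
  shows "h s = 0"
proof -
  define d where "d = min (p - a) (b - p)"
  have d: "d > 0" using I by (simp add: d_def)
  have ivl: "is_interval I" using L by (simp add: loewner_def)
  have p: "p \<in> I" using ivl I mem_is_interval_1_I[of I a b p] by auto
  have sI: "s \<in> I" using ivl I s p mem_is_interval_1_I[of I p b s] by auto
  have bound: "\<bar>qform (div_diff2 m g p) S c c\<bar> \<le> 1 / d * qform (div_diff m g) S c c"
    if S: "finite S" "S \<subseteq> I" "p \<notin> S" for S c
  proof -
    have N: "0 \<le> qform (div_diff m g) S c c" using L S by (simp add: loewner_def)
    have "qform (div_diff m g) S c c / (b - p) \<le> qform (div_diff m g) S c c / d"
      "qform (div_diff m g) S c c / (p - a) \<le> qform (div_diff m g) S c c / d"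
      using N d by (intro divide_left_mono; simp add: d_def)+
    then show ?thesis
      using div_diff2_upper[OF L S p I(2,4), of c] div_diff2_lower[OF L S p I(1,3), of c] by (simp add: abs_le_iff)
  qed
  have *: "(\<Sum>i\<in>S. c i * h i / (i - p) ^ n)\<^sup>2 \<le> (1 / d) ^ (2 * n) * qform (div_diff m g) S c c"
    if "finite S" "S \<subseteq> I" "p \<notin> S" for S c n
    using that
  proof (induction n arbitrary: S c)
    case 0
    then show ?case using h by simp
  next
    case (Suc n)
    define w where "w = (\<lambda>i. c i / (i - p))"
    note res = resolvent_norm_bound[OF L p Suc.prems _ bound, of w c]
    \<comment> \<open>The auxiliary node approaches \<open>p\<close> from the left, where
      \<open>h\<close> vanishes: it contributes nothing to the sum with \<open>h\<close>, while the
      form converges to the squared norm of \<open>R p v\<close>.\<close>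
    have "((\<lambda>q. (1 / d) ^ (2 * n) * qform (div_diff m g) (insert q S) (w(q := - sum w S)) (w(q := - sum w S))) \<longlongrightarrow>
      (1 / d) ^ (2 * n) * qform (div_diff m g) (insert p S) (w(p := - sum w S)) (w(p := - sum w S))) (at_left p)"
      by (intro tendsto_mult tendsto_const tendsto_mono[OF at_le res(1)]) (use d in \<open>auto simp: w_def\<close>)
    moreover have "\<forall>\<^sub>F q in at_left p. (\<Sum>i\<in>S. c i * h i / (i - p) ^ Suc n)\<^sup>2 \<le>
        (1 / d) ^ (2 * n) * qform (div_diff m g) (insert q S) (w(q := - sum w S)) (w(q := - sum w S))"
    proof -
      have "\<forall>\<^sub>F q in at_left p. q \<in> - S"
        using Suc.prems by (intro topological_tendstoD[OF tendsto_ident_at]) (auto simp: finite_imp_closed open_Compl)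
      moreover have "\<forall>\<^sub>F q in at_left p. q \<in> I"
        using L p by (intro topological_tendstoD[OF tendsto_ident_at]) (auto simp: loewner_def)
      moreover have "\<forall>\<^sub>F q in at_left p. q < p" by (simp add: eventually_at_filter)
      ultimately show ?thesis
      proof eventually_elim
        case (elim q)
        have "(\<Sum>i\<in>insert q S. (w(q := - sum w S)) i * h i / (i - p) ^ n) = (\<Sum>i\<in>S. (w(q := - sum w S)) i * h i / (i - p) ^ n)"
          using elim zero[of q] Suc.prems by simp
        also have "\<dots> = (\<Sum>i\<in>S. c i * h i / (i - p) ^ Suc n)"
          using elim by (intro sum.cong refl) (auto simp: w_def)
        finally have eq: "(\<Sum>i\<in>insert q S. (w(q := - sum w S)) i * h i / (i - p) ^ n) = \<dots>" .
        show ?case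
          unfolding eq[symmetric] by (rule Suc.IH) (use elim Suc.prems in auto)
      qed
    qed
    ultimately have "(\<Sum>i\<in>S. c i * h i / (i - p) ^ Suc n)\<^sup>2 \<le>
        (1 / d) ^ (2 * n) * qform (div_diff m g) (insert p S) (w(p := - sum w S)) (w(p := - sum w S))"
      by (intro tendsto_lowerbound) auto
    also have "\<dots> \<le> (1 / d) ^ (2 * n) * ((1 / d)\<^sup>2 * qform (div_diff m g) S c c)"
      using res(2) d by (intro mult_left_mono) (auto simp: w_def)
    finally show ?case by (simp add: power2_eq_square mult_ac)
  qed
  \<comment> \<open>The single node \<open>s\<close> with weight \<open>1\<close>, whose form is
    \<open>g s\<close>; the factor decays as \<open>n\<close> grows because
    \<open>s - p < d\<close>.\<close>
  have le: "(h s)\<^sup>2 \<le> ((s - p) / d) ^ (2 * n) * g s" for n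
  proof -
    have "(h s / (s - p) ^ n)\<^sup>2 \<le> (1 / d) ^ (2 * n) * g s"
      using *[of "{s}" "\<lambda>_. 1" n] sI s by (simp add: qform_def div_diff_def)
    then have le: "(h s / (s - p) ^ n)\<^sup>2 * (s - p) ^ (2 * n) \<le> (1 / d) ^ (2 * n) * g s * (s - p) ^ (2 * n)"
      using s by (intro mult_right_mono) auto
    have e: "(1 / d) ^ k * y * (s - p) ^ k = ((s - p) / d) ^ k * y" for k y
      by (simp add: power_divide)
    have "((s - p) ^ n)\<^sup>2 = (s - p) ^ (2 * n)"
      by (metis power_even_eq)
    then have "(h s / (s - p) ^ n)\<^sup>2 * (s - p) ^ (2 * n) = (h s)\<^sup>2"
      using s by (simp add: power_divide)
    then show ?thesis using le unfolding e by (simp only:)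
  qed
  define r where "r = (s - p) / d"
  have r: "0 \<le> r" "r < 1" using s d by (auto simp: d_def[symmetric] r_def)
  have "r\<^sup>2 < 1" using r mult_strict_mono'[of r 1 r 1] by (simp add: power2_eq_square)
  then have "(\<lambda>n. (r\<^sup>2) ^ n) \<longlonglongrightarrow> 0" by (intro LIMSEQ_power_zero) simp
  then have "(\<lambda>n. (r\<^sup>2) ^ n * g s) \<longlonglongrightarrow> 0 * g s"
    by (rule tendsto_mult[OF _ tendsto_const])
  moreover have "(h s)\<^sup>2 \<le> (r\<^sup>2) ^ n * g s" for n
    using le[of n] unfolding r_def power_mult .
  ultimately have "(h s)\<^sup>2 \<le> 0 * g s"
    by (intro LIMSEQ_le_const) auto
  then show ?thesis by simp
qed

lemma unique_continuation_left:
  assumes L: "loewner I m g" and I: "a \<in> I" "b \<in> I" "a < p" "p < b"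
    and h: "\<And>S c. finite S \<Longrightarrow> S \<subseteq> I \<Longrightarrow> (\<Sum>i\<in>S. c i * h i)\<^sup>2 \<le> qform (div_diff m g) S c c"
    and zero: "\<And>q. q \<in> I \<Longrightarrow> p \<le> q \<Longrightarrow> h q = 0"
    and s: "s < p" "p - min (p - a) (b - p) < s"
  shows "h s = 0"
proof -
  have "h (- (- s)) = 0"
  proof (rule unique_continuation_right[OF loewner_reflect[OF L], of "- b" "- a" "- p" "\<lambda>i. h (- i)"])
    show "(\<Sum>i\<in>S. c i * h (- i))\<^sup>2 \<le> qform (div_diff (\<lambda>s. - m (- s)) (\<lambda>s. g (- s))) S c c"
      if "finite S" "S \<subseteq> uminus ` I" for S c
    proof -
      have "uminus ` S \<subseteq> I" using that by auto
      then show ?thesis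
        using h[of "uminus ` S" "\<lambda>i. c (- i)"] that qform_reflect[of "div_diff m g" S c c]
        unfolding div_diff_reflect by (simp add: sum.reindex)
    qed
  qed (use I zero s in auto)
  then show ?thesis by simp
qed

section \<open>Kinetic relation on the half-plane\<close>

lemma AE_lborel_continuous_eq_0:
  fixes f :: "'a::euclidean_space \<Rightarrow> real"
  assumes "AE z in lborel. f z = 0" "continuous_on UNIV f"
  shows "f z = 0"
proof -
  let ?A = "{z. f z \<noteq> 0}"
  have "open ?A" using assms(2) by (intro open_Collect_neq) (auto intro: continuous_intros)
  moreover have "?A \<in> null_sets lborel"
    using assms(1) \<open>open ?A\<close> AE_iff_null_sets[of ?A lborel] by auto
  then have "negligible ?A" by (simp add: negligible_iff_null_sets null_sets_completionI)
  ultimately have "?A = {}" using open_not_negligible by blast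
  then show ?thesis by blast
qed

text \<open>Along a convergent sequence of parameters \<open>B\<close> stays bounded, which is
  enough for dominated convergence. The factor \<open>B\<close> admits bounds such as that of
  \<open>uk_le_D\<close>, which grow with the parameter.\<close>

lemma continuous_on_integral_dominated:
  fixes F :: "'b::metric_space \<Rightarrow> 'a \<Rightarrow> real"
  assumes "\<And>z. F z \<in> borel_measurable M" "integrable M D" "continuous_on UNIV B"
    and cont: "\<And>\<omega>. \<omega> \<in> space M \<Longrightarrow> continuous_on UNIV (\<lambda>z. F z \<omega>)"
    and bound: "\<And>z \<omega>. \<omega> \<in> space M \<Longrightarrow> \<bar>F z \<omega>\<bar> \<le> B z * D \<omega>"
    and D: "\<And>\<omega>. \<omega> \<in> space M \<Longrightarrow> 0 \<le> D \<omega>"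
  shows "continuous_on UNIV (\<lambda>z. \<integral>\<omega>. F z \<omega> \<partial>M)"
  unfolding continuous_on_sequentially
proof (intro allI ballI impI, elim conjE)
  fix X :: "nat \<Rightarrow> 'b" and z assume X: "X \<longlonglongrightarrow> z"
  have "(\<lambda>n. B (X n)) \<longlonglongrightarrow> B z"
    using assms(3) X by (auto simp: continuous_on_sequentially comp_def)
  then obtain K where K: "\<And>n. \<bar>B (X n)\<bar> \<le> K"
    using convergent_imp_Bseq[of "\<lambda>n. B (X n)"] by (auto simp: convergent_def Bseq_def)
  have "(\<lambda>n. \<integral>\<omega>. F (X n) \<omega> \<partial>M) \<longlonglongrightarrow> (\<integral>\<omega>. F z \<omega> \<partial>M)"
  proof (rule integral_dominated_convergence[where w = "\<lambda>\<omega>. K * D \<omega>"])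
    show "AE \<omega> in M. (\<lambda>n. F (X n) \<omega>) \<longlonglongrightarrow> F z \<omega>"
      using cont X by (intro AE_I2) (auto simp: continuous_on_sequentially comp_def)
    show "AE \<omega> in M. norm (F (X n) \<omega>) \<le> K * D \<omega>" for n
    proof (intro AE_I2)
      fix \<omega> assume "\<omega> \<in> space M"
      then have "\<bar>F (X n) \<omega>\<bar> \<le> B (X n) * D \<omega>" "0 \<le> D \<omega>" using bound D by auto
      moreover have "B (X n) \<le> K" using K[of n] by linarith
      ultimately show "norm (F (X n) \<omega>) \<le> K * D \<omega>"
        by (metis mult_right_mono order_trans real_norm_def)
    qed
  qed (use assms in auto)
  then show "((\<lambda>z. \<integral>\<omega>. F z \<omega> \<partial>M) \<circ> X) \<longlonglongrightarrow> (\<integral>\<omega>. F z \<omega> \<partial>M)" by (simp add: comp_def)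
qed

text \<open>States enter only through their coordinates, with equality
  \<open>y \<omega> = x \<omega>\<close> for the vacuum, and \<open>D\<close> plays the role of the
  weight \<open>W\<close>. The powers \<open>2 * l\<close>, \<open>4 * l\<close> and
  \<open>2 * l + 1\<close> of the half-width control \<open>k s\<close>, \<open>k s * k t\<close>
  and \<open>u * k s\<close> respectively.\<close>

locale kinetic = prob_space M for M :: "'a measure" +
  fixes x y D :: "'a \<Rightarrow> real" and l th :: real
  assumes x [measurable]: "x \<in> borel_measurable M" and y [measurable]: "y \<in> borel_measurable M"
    and y_le_x: "\<omega> \<in> space M \<Longrightarrow> y \<omega> \<le> x \<omega>"
    and l: "0 < l" and th: "th * (2 * l + 1) = 1"
    and D: "integrable M D"
    and r_le: "\<omega> \<in> space M \<Longrightarrow> ((x \<omega> - y \<omega>) / 2) powr (2 * l) \<le> D \<omega>"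
      "\<omega> \<in> space M \<Longrightarrow> ((x \<omega> - y \<omega>) / 2) powr (4 * l) \<le> D \<omega>"
      "\<omega> \<in> space M \<Longrightarrow> ((x \<omega> - y \<omega>) / 2) powr (2 * l + 1) \<le> D \<omega>"
begin

text \<open>\<open>k\<close> is the entropy kernel \<open>\<chi>\<close>, and \<open>f\<close>, \<open>N\<close>, \<open>C\<close> are \<open>\<langle>\<chi>\<rangle>\<close>, \<open>\<langle>u \<chi>\<rangle>\<close> and \<open>\<langle>\<chi>(s) \<chi>(t)\<rangle>\<close>.\<close>

definition k :: "real \<Rightarrow> 'a \<Rightarrow> real" where
  "k s \<omega> = max ((x \<omega> - s) * (s - y \<omega>)) 0 powr l"

definition u :: "'a \<Rightarrow> real" where
  "u \<omega> = (x \<omega> + y \<omega>) / 2"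

definition f :: "real \<Rightarrow> real" where
  "f s = (\<integral>\<omega>. k s \<omega> \<partial>M)"

definition N :: "real \<Rightarrow> real" where
  "N s = (\<integral>\<omega>. u \<omega> * k s \<omega> \<partial>M)"

definition C :: "real \<Rightarrow> real \<Rightarrow> real" where
  "C s t = (\<integral>\<omega>. k s \<omega> * k t \<omega> \<partial>M)"

section \<open>Domination and continuity of the averages\<close>

lemma k_measurable [measurable]: "k s \<in> borel_measurable M"
  unfolding k_def by measurable

lemma u_measurable [measurable]: "u \<in> borel_measurable M"
  unfolding u_def by measurable

lemma k_nonneg [simp]: "0 \<le> k s \<omega>"
  by (simp add: k_def)

lemma k_pos_iff:
  assumes "\<omega> \<in> space M"
  shows "0 < k s \<omega> \<longleftrightarrow> y \<omega> < s \<and> s < x \<omega>"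
proof -
  have "0 < k s \<omega> \<longleftrightarrow> 0 < (x \<omega> - s) * (s - y \<omega>)" by (auto simp: k_def)
  then show ?thesis using y_le_x[OF assms] by (auto simp: zero_less_mult_iff)
qed

lemma k_eq_0_iff:
  assumes "\<omega> \<in> space M"
  shows "k s \<omega> = 0 \<longleftrightarrow> \<not> (y \<omega> < s \<and> s < x \<omega>)"
  using k_pos_iff[OF assms, of s] k_nonneg[of s \<omega>] by linarith

lemma k_continuous: "continuous_on UNIV (\<lambda>s. k s \<omega>)"
  unfolding k_def using l by (intro continuous_on_powr' continuous_intros) auto

lemma k_le_powr: "\<omega> \<in> space M \<Longrightarrow> k s \<omega> \<le> ((x \<omega> - y \<omega>) / 2) powr (2 * l)"
proof -
  assume "\<omega> \<in> space M"
  define r where "r = (x \<omega> - y \<omega>) / 2"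
  have r: "0 \<le> r" using y_le_x[OF \<open>\<omega> \<in> space M\<close>] by (simp add: r_def)
  have "(x \<omega> - s) * (s - y \<omega>) = r\<^sup>2 - (s - (x \<omega> + y \<omega>) / 2)\<^sup>2"
    by (simp add: r_def field_simps power2_eq_square)
  then have "max ((x \<omega> - s) * (s - y \<omega>)) 0 \<le> r\<^sup>2" by simp
  then have "k s \<omega> \<le> (r\<^sup>2) powr l" unfolding k_def using l by (intro powr_mono2) auto
  also have "(r\<^sup>2) powr l = r powr (2 * l)"
    using r by (cases "r = 0") (auto simp: powr_powr[symmetric] powr_numeral)
  finally show ?thesis by (simp add: r_def)
qed

lemma D_nonneg: "\<omega> \<in> space M \<Longrightarrow> 0 \<le> D \<omega>"
  using r_le(1) powr_ge_zero order_trans by blast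

lemma k_le_D: "\<omega> \<in> space M \<Longrightarrow> \<bar>k s \<omega>\<bar> \<le> D \<omega>"
  using k_le_powr[of \<omega> s] r_le(1)[of \<omega>] by simp

lemma kk_le_D:
  assumes "\<omega> \<in> space M"
  shows "\<bar>k s \<omega> * k t \<omega>\<bar> \<le> D \<omega>"
proof -
  have "k s \<omega> * k t \<omega> \<le> ((x \<omega> - y \<omega>) / 2) powr (2 * l) * ((x \<omega> - y \<omega>) / 2) powr (2 * l)"
    using k_le_powr[OF assms] by (intro mult_mono) auto
  also have "\<dots> = ((x \<omega> - y \<omega>) / 2) powr (4 * l)" by (simp add: powr_add[symmetric])
  also have "\<dots> \<le> D \<omega>" by (rule r_le(2)[OF assms])
  finally show ?thesis by (simp add: abs_mult)
qed

lemma uk_le_D: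
  assumes "\<omega> \<in> space M"
  shows "\<bar>u \<omega> * k s \<omega>\<bar> \<le> (\<bar>s\<bar> + 1) * D \<omega>"
proof (cases "k s \<omega> = 0")
  case True
  then show ?thesis using D_nonneg[OF assms] by simp
next
  case False
  define r where "r = (x \<omega> - y \<omega>) / 2"
  have "y \<omega> < s" "s < x \<omega>" using False k_eq_0_iff[OF assms] by auto
  \<comment> \<open>Where the kernel is nonzero, \<open>s\<close> lies in the state interval, whose
    centre is \<open>u \<omega>\<close> and half-width \<open>r\<close>.\<close>
  then have u: "\<bar>u \<omega>\<bar> \<le> \<bar>s\<bar> + r" and r: "0 < r" unfolding u_def r_def by (auto simp: abs_le_iff field_simps)
  have "\<bar>u \<omega> * k s \<omega>\<bar> \<le> (\<bar>s\<bar> + r) * r powr (2 * l)"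
    using k_le_powr[OF assms, of s] u unfolding abs_mult r_def by (intro mult_mono) auto
  also have "\<dots> = \<bar>s\<bar> * r powr (2 * l) + r powr (2 * l + 1)"
    using r by (simp add: powr_add algebra_simps)
  also have "\<dots> \<le> \<bar>s\<bar> * D \<omega> + D \<omega>"
    using r_le(1,3)[OF assms] unfolding r_def by (intro add_mono mult_left_mono) auto
  finally show ?thesis by (simp add: algebra_simps)
qed

lemma integrable_k: "integrable M (k s)"
  by (rule Bochner_Integration.integrable_bound[OF D]) (use k_le_D D_nonneg in \<open>auto intro!: AE_I2\<close>)

lemma integrable_kk: "integrable M (\<lambda>\<omega>. k s \<omega> * k t \<omega>)"
  by (rule Bochner_Integration.integrable_bound[OF D]) (use kk_le_D D_nonneg in \<open>auto intro!: AE_I2\<close>)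

lemma integrable_uk: "integrable M (\<lambda>\<omega>. u \<omega> * k s \<omega>)"
proof (rule Bochner_Integration.integrable_bound)
  show "integrable M (\<lambda>\<omega>. (\<bar>s\<bar> + 1) * D \<omega>)" using D by simp
  show "AE \<omega> in M. norm (u \<omega> * k s \<omega>) \<le> norm ((\<bar>s\<bar> + 1) * D \<omega>)"
    using uk_le_D[of _ s] D_nonneg by (intro AE_I2) (simp add: abs_mult)
qed measurable

lemma f_continuous: "continuous_on UNIV f"
  unfolding f_def
  by (rule continuous_on_integral_dominated[OF _ D, of _ "\<lambda>_. 1"]) (use k_continuous k_le_D D_nonneg in auto)

lemma N_continuous: "continuous_on UNIV N"
  unfolding N_def
  by (rule continuous_on_integral_dominated[OF _ D, of _ "\<lambda>s. \<bar>s\<bar> + 1"])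
    (use k_continuous uk_le_D D_nonneg in \<open>auto intro!: continuous_intros\<close>)

lemma C_continuous: "continuous_on UNIV (\<lambda>z. C (fst z) (snd z))"
  unfolding C_def
proof (rule continuous_on_integral_dominated[OF _ D, of _ "\<lambda>_. 1"])
  show "continuous_on UNIV (\<lambda>z. k (fst z) \<omega> * k (snd z) \<omega>)" for \<omega>
    by (intro continuous_on_mult continuous_on_compose2[OF k_continuous] continuous_intros) auto
qed (use kk_le_D D_nonneg in auto)

end

lemma (in prob_space) square_expectation_le:
  fixes X :: "'a \<Rightarrow> real"
  assumes "integrable M X" "integrable M (\<lambda>\<omega>. (X \<omega>)\<^sup>2)"
  shows "(\<integral>\<omega>. X \<omega> \<partial>M)\<^sup>2 \<le> (\<integral>\<omega>. (X \<omega>)\<^sup>2 \<partial>M)"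
  using variance_positive[of X] variance_eq[OF assms] by simp

locale admissible = kinetic +
  assumes adm: "AE (s, t) in (lborel :: (real \<times> real) measure).
    (\<integral>\<omega>. k s \<omega> * ((th * t + (1 - th) * u \<omega>) * k t \<omega>) - ((th * s + (1 - th) * u \<omega>) * k s \<omega>) * k t \<omega> \<partial>M)
    - (\<integral>\<omega>. k s \<omega> \<partial>M) * (\<integral>\<omega>. (th * t + (1 - th) * u \<omega>) * k t \<omega> \<partial>M)
    + (\<integral>\<omega>. (th * s + (1 - th) * u \<omega>) * k s \<omega> \<partial>M) * (\<integral>\<omega>. k t \<omega> \<partial>M) = 0"
begin

text \<open>The terms with \<open>u\<close> cancel in the averaged commutator, which leaves
  \<open>th * (t - s) * C s t\<close>; by \<open>1 - th = 2 * l * th\<close> a factor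
  \<open>th\<close> splits off everywhere. Both sides are continuous, so the exceptional null set
  disappears.\<close>

lemma rel: "(t - s) * C s t = (t - s) * f s * f t + 2 * l * (f s * N t - f t * N s)"
proof -
  define Q where "Q = (\<lambda>z. (snd z - fst z) * (C (fst z) (snd z) - f (fst z) * f (snd z))
     - 2 * l * (f (fst z) * N (snd z) - f (snd z) * N (fst z)))"
  have [continuous_intros]: "continuous_on UNIV (\<lambda>z::real \<times> real. f (fst z))" "continuous_on UNIV (\<lambda>z::real \<times> real. f (snd z))"
    "continuous_on UNIV (\<lambda>z::real \<times> real. N (fst z))" "continuous_on UNIV (\<lambda>z::real \<times> real. N (snd z))"
    by (rule continuous_on_compose2[OF f_continuous] continuous_on_compose2[OF N_continuous]; (intro continuous_intros)?; simp)+
  have "continuous_on UNIV Q"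
    unfolding Q_def by (intro continuous_on_diff continuous_on_mult C_continuous continuous_intros)
  moreover have "AE z in lborel. Q z = 0"
    using adm
  proof eventually_elim
    case (elim z)
    obtain s t where z: "z = (s, t)" by (cases z)
    have th1: "1 - th = 2 * l * th" using th by (simp add: algebra_simps)
    have sg: "(\<integral>\<omega>. (th * t + (1 - th) * u \<omega>) * k t \<omega> \<partial>M) = th * (t * f t + 2 * l * N t)" for t
    proof -
      have "(\<integral>\<omega>. (th * t + (1 - th) * u \<omega>) * k t \<omega> \<partial>M) = (\<integral>\<omega>. (th * t) * k t \<omega> + (1 - th) * (u \<omega> * k t \<omega>) \<partial>M)"
        by (intro Bochner_Integration.integral_cong) (auto simp: algebra_simps)
      also have "\<dots> = (th * t) * f t + (1 - th) * N t"
        unfolding f_def N_def using integrable_k integrable_uk by simp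
      finally show ?thesis unfolding th1 by (simp add: algebra_simps)
    qed
    have "(\<integral>\<omega>. k s \<omega> * ((th * t + (1 - th) * u \<omega>) * k t \<omega>) - ((th * s + (1 - th) * u \<omega>) * k s \<omega>) * k t \<omega> \<partial>M)
        = (\<integral>\<omega>. th * (t - s) * (k s \<omega> * k t \<omega>) \<partial>M)"
      by (intro Bochner_Integration.integral_cong) (auto simp: algebra_simps)
    also have "\<dots> = th * (t - s) * C s t" by (simp add: C_def)
    finally have "th * (t - s) * C s t - f s * (th * (t * f t + 2 * l * N t)) + (th * (s * f s + 2 * l * N s)) * f t = 0"
      using elim unfolding z by (simp add: sg f_def[symmetric])
    then have "th * Q z = 0" unfolding Q_def z by (simp add: algebra_simps)
    moreover have "th \<noteq> 0" using th by auto
    ultimately show ?case by simp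
  qed
  ultimately have "Q (s, t) = 0" by (intro AE_lborel_continuous_eq_0)
  then show ?thesis by (simp add: Q_def algebra_simps)
qed

definition I :: "real set" where
  "I = {s. 0 < f s}"

lemma f_nonneg: "0 \<le> f s"
  by (simp add: f_def integral_nonneg_AE)

lemma open_I: "open I"
  unfolding I_def using f_continuous by (intro open_Collect_less) (auto intro: continuous_intros)

lemma not_in_I: "s \<notin> I \<Longrightarrow> AE \<omega> in M. \<not> (y \<omega> < s \<and> s < x \<omega>)"
proof -
  assume "s \<notin> I"
  then have "f s = 0" using f_nonneg[of s] by (simp add: I_def)
  then have "AE \<omega> in M. k s \<omega> = 0"
    unfolding f_def using integral_nonneg_eq_0_iff_AE[OF integrable_k] by simp
  then show ?thesis using AE_space by eventually_elim (simp add: k_eq_0_iff)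
qed

text \<open>If \<open>f c = 0\<close> then almost no state interval contains \<open>c\<close>, so the averages \<open>N / f\<close> left and right of \<open>c\<close> are separated by
  \<open>c\<close> and \<open>C\<close> vanishes across \<open>c\<close>, which contradicts \<open>rel\<close>.\<close>

lemma interval_I: "is_interval I"
  unfolding is_interval_1
proof (intro ballI allI impI)
  fix s t c assume st: "s \<in> I" "t \<in> I" "s \<le> c \<and> c \<le> t"
  show "c \<in> I"
  proof (rule ccontr)
    assume c: "c \<notin> I"
    have lt: "s < c" "c < t" using st c by (auto simp: less_le)
    note ae = not_in_I[OF c]
    have "C s t = 0"
      unfolding C_def using ae AE_space
      by (intro integral_eq_zero_AE, eventually_elim) (use lt in \<open>auto simp: k_eq_0_iff\<close>)
    moreover have "c * f t \<le> N t"
      unfolding f_def N_def integral_mult_right_zero[symmetric]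
    proof (rule integral_mono_AE)
      show "AE \<omega> in M. c * k t \<omega> \<le> u \<omega> * k t \<omega>"
        using ae AE_space
      proof eventually_elim
        case (elim \<omega>)
        have "c \<le> u \<omega>" if "k t \<omega> \<noteq> 0"
          using that elim lt k_eq_0_iff[of \<omega> t] by (auto simp: u_def)
        then show ?case by (cases "k t \<omega> = 0") (auto intro: mult_right_mono)
      qed
    qed (use integrable_k integrable_uk in auto)
    moreover have "N s \<le> c * f s"
      unfolding f_def N_def integral_mult_right_zero[symmetric]
    proof (rule integral_mono_AE)
      show "AE \<omega> in M. u \<omega> * k s \<omega> \<le> c * k s \<omega>"
        using ae AE_space
      proof eventually_elim
        case (elim \<omega>)
        have "u \<omega> \<le> c" if "k s \<omega> \<noteq> 0"
          using that elim lt k_eq_0_iff[of \<omega> s] by (auto simp: u_def)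
        then show ?case by (cases "k s \<omega> = 0") (auto intro: mult_right_mono)
      qed
    qed (use integrable_k integrable_uk in auto)
    ultimately have "f s * (c * f t) \<le> f s * N t" "f t * N s \<le> f t * (c * f s)" "C s t = 0"
      using f_nonneg by (auto intro: mult_left_mono)
    moreover have "f s * (c * f t) = f t * (c * f s)" by simp
    ultimately have "0 \<le> f s * N t - f t * N s" by linarith
    then have "0 \<le> 2 * l * (f s * N t - f t * N s)" using l by simp
    moreover have "0 < (t - s) * f s * f t" using st lt by (simp add: I_def)
    ultimately show False using rel[of t s] \<open>C s t = 0\<close> by simp
  qed
qed

section \<open>The Loewner kernel of an admissible measure\<close>

definition m :: "real \<Rightarrow> real" where
  "m s = s + 2 * l * N s / f s"

definition g :: "real \<Rightarrow> real" where
  "g s = C s s / (f s * f s)"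

lemma div_diff_eq:
  assumes "s \<in> I" "t \<in> I"
  shows "div_diff m g s t = C s t / (f s * f t)"
proof (cases "s = t")
  case False
  have pos: "f s \<noteq> 0" "f t \<noteq> 0" using assms by (auto simp: I_def)
  have "(s - t) * (C s t / (f s * f t)) = m s - m t"
    using rel[of t s] pos unfolding m_def by (simp add: field_simps)
  then show ?thesis using False by (simp add: div_diff_def field_simps)
qed (simp add: div_diff_def g_def)

text \<open>The combination of the normalized kernels \<open>X i\<close> as a square integrable
  function of the state; its squared norm realises the abstract quadratic form.\<close>

definition v :: "real set \<Rightarrow> (real \<Rightarrow> real) \<Rightarrow> 'a \<Rightarrow> real" where
  "v S c \<omega> = (\<Sum>i\<in>S. c i / f i * k i \<omega>)"

lemma v_square: "(v S c \<omega>)\<^sup>2 = (\<Sum>i\<in>S. \<Sum>j\<in>S. c i * c j / (f i * f j) * (k i \<omega> * k j \<omega>))"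
  unfolding v_def power2_eq_square sum_product by (intro sum.cong refl) simp

lemma integrable_v: "integrable M (v S c)"
  unfolding v_def using integrable_k by simp

lemma integrable_v2: "integrable M (\<lambda>\<omega>. (v S c \<omega>)\<^sup>2)"
  unfolding v_square using integrable_kk by (intro Bochner_Integration.integrable_sum integrable_mult_right)

lemma qform_eq:
  assumes "S \<subseteq> I"
  shows "qform (div_diff m g) S c c = (\<integral>\<omega>. (v S c \<omega>)\<^sup>2 \<partial>M)"
proof -
  have "(\<integral>\<omega>. (v S c \<omega>)\<^sup>2 \<partial>M) = (\<Sum>i\<in>S. \<Sum>j\<in>S. c i * c j / (f i * f j) * C i j)"
    unfolding v_square C_def using integrable_kk
    by (simp add: Bochner_Integration.integral_sum)
  also have "\<dots> = qform (div_diff m g) S c c"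
    unfolding qform_def using assms by (intro sum.cong refl) (subst div_diff_eq, auto)
  finally show ?thesis by simp
qed

lemma C_continuous_at: "((\<lambda>t. C t s) \<longlongrightarrow> C s s) (at s)"
proof -
  have "continuous_on UNIV (\<lambda>t. C (fst (t, s)) (snd (t, s)))"
    by (rule continuous_on_compose2[OF C_continuous]) (auto intro!: continuous_intros)
  then show ?thesis by (simp add: continuous_on_def)
qed

text \<open>Differentiability comes from the relation itself: the difference quotient of
  \<open>m\<close> is \<open>C t s / (f t * f s)\<close>, which is continuous up to
  \<open>t = s\<close>. Positivity holds because the form integrates a square.\<close>

lemma loewner_m: "loewner I m g"
  unfolding loewner_def
proof (intro conjI allI impI ballI open_I interval_I)
  fix s assume s: "s \<in> I"
  then have pos: "f s \<noteq> 0" by (simp add: I_def)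
  have fl: "(f \<longlongrightarrow> f s) (at s)" using f_continuous by (simp add: continuous_on_def)
  have "((\<lambda>t. C t s / (f t * f s)) \<longlongrightarrow> C s s / (f s * f s)) (at s)"
    using pos by (intro tendsto_divide tendsto_mult tendsto_const C_continuous_at fl) auto
  moreover have "\<forall>\<^sub>F t in at s. C t s / (f t * f s) = (m t - m s) / (t - s)"
  proof -
    have "\<forall>\<^sub>F t in at s. t \<in> I" using open_I s by (intro topological_tendstoD[OF tendsto_ident_at]) auto
    moreover have "\<forall>\<^sub>F t in at s. t \<noteq> s" by (simp add: eventually_at_filter)
    ultimately show ?thesis
    proof eventually_elim
      case (elim t)
      then show ?case using div_diff_eq[OF elim(1) s] by (simp add: div_diff_def)
    qed
  qed
  ultimately show "(m has_real_derivative g s) (at s)"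
    unfolding has_field_derivative_iff g_def by (rule Lim_transform_eventually)
next
  have "continuous_on UNIV (\<lambda>s. C (fst (s, s)) (snd (s, s)))"
    by (rule continuous_on_compose2[OF C_continuous]) (auto intro!: continuous_intros)
  then have "continuous_on I (\<lambda>s. C s s)" by (auto intro: continuous_on_subset)
  moreover have "continuous_on I f" using f_continuous by (auto intro: continuous_on_subset)
  ultimately show "continuous_on I g"
    unfolding g_def by (intro continuous_on_divide continuous_on_mult) (auto simp: I_def)
next
  fix S c assume "finite S" "S \<subseteq> I"
  then show "0 \<le> qform (div_diff m g) S c c" by (subst qform_eq) (auto intro: integral_nonneg_AE)
qed

definition h :: "'a set \<Rightarrow> real \<Rightarrow> real" where
  "h B s = (\<integral>\<omega>. indicator B \<omega> * k s \<omega> \<partial>M) / f s"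

lemma integrable_indicator_k: "B \<in> sets M \<Longrightarrow> integrable M (\<lambda>\<omega>. indicator B \<omega> * k s \<omega>)"
  using integrable_mult_indicator[OF _ integrable_k[of s], of B] by simp

text \<open>Cauchy-Schwarz against the indicator of \<open>B\<close>, whose norm is at most one in a
  probability space.\<close>

lemma h_bound:
  assumes B: "B \<in> sets M" and S: "finite S" "S \<subseteq> I"
  shows "(\<Sum>i\<in>S. c i * h B i)\<^sup>2 \<le> qform (div_diff m g) S c c"
proof -
  have int: "integrable M (\<lambda>\<omega>. indicator B \<omega> * v S c \<omega>)"
    using integrable_mult_indicator[OF B integrable_v[of S c]] by simp
  have sq: "(indicator B \<omega> * v S c \<omega>)\<^sup>2 = indicator B \<omega> * (v S c \<omega>)\<^sup>2" for \<omega>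
    by (simp add: indicator_def)
  have int2: "integrable M (\<lambda>\<omega>. (indicator B \<omega> * v S c \<omega>)\<^sup>2)"
    unfolding sq using integrable_mult_indicator[OF B integrable_v2[of S c]] by simp
  have "(\<integral>\<omega>. indicator B \<omega> * v S c \<omega> \<partial>M) = (\<integral>\<omega>. (\<Sum>i\<in>S. c i / f i * (indicator B \<omega> * k i \<omega>)) \<partial>M)"
    unfolding v_def by (intro Bochner_Integration.integral_cong refl) (simp add: sum_distrib_left mult_ac)
  also have "\<dots> = (\<Sum>i\<in>S. c i / f i * (\<integral>\<omega>. indicator B \<omega> * k i \<omega> \<partial>M))"
    using integrable_indicator_k[OF B] by (simp add: Bochner_Integration.integral_sum)
  also have "\<dots> = (\<Sum>i\<in>S. c i * h B i)" by (simp add: h_def)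
  finally have "(\<Sum>i\<in>S. c i * h B i)\<^sup>2 \<le> (\<integral>\<omega>. (indicator B \<omega> * v S c \<omega>)\<^sup>2 \<partial>M)"
    using square_expectation_le[OF int int2] by simp
  also have "\<dots> \<le> (\<integral>\<omega>. (v S c \<omega>)\<^sup>2 \<partial>M)"
    by (intro integral_mono int2 integrable_v2) (simp add: indicator_def)
  finally show ?thesis using qform_eq[OF S(2)] by simp
qed

lemma h_eq_0D:
  assumes B: "B \<in> sets M" and s: "s \<in> I" and h: "h B s = 0"
  shows "AE \<omega> in M. \<not> (\<omega> \<in> B \<and> y \<omega> < s \<and> s < x \<omega>)"
proof -
  have "(\<integral>\<omega>. indicator B \<omega> * k s \<omega> \<partial>M) = 0" using h s by (auto simp: h_def I_def)
  then have "AE \<omega> in M. indicator B \<omega> * k s \<omega> = 0"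
    by (subst (asm) integral_nonneg_eq_0_iff_AE[OF integrable_indicator_k[OF B]]) auto
  then show ?thesis using AE_space
    by eventually_elim (auto simp: k_eq_0_iff indicator_def split: if_splits)
qed

lemma h_eq_0I:
  assumes "\<And>\<omega>. \<omega> \<in> space M \<Longrightarrow> \<omega> \<in> B \<Longrightarrow> \<not> (y \<omega> < s \<and> s < x \<omega>)"
  shows "h B s = 0"
proof -
  have "(\<integral>\<omega>. indicator B \<omega> * k s \<omega> \<partial>M) = (\<integral>\<omega>. 0 \<partial>M)"
    using assms k_eq_0_iff by (intro Bochner_Integration.integral_cong) (auto simp: indicator_def)
  then show ?thesis by (simp add: h_def)
qed

section \<open>Locating the endpoints of the state intervals\<close>

lemma no_left_endpoint_aux:
  assumes I: "a \<in> I" "b \<in> I" "a < p" "p < b" and s: "p < s" "s < p + min (p - a) (b - p)"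
  shows "AE \<omega> in M. \<not> (p \<le> y \<omega> \<and> y \<omega> < s \<and> s < x \<omega>)"
proof -
  let ?B = "{\<omega> \<in> space M. p \<le> y \<omega>}"
  have B: "?B \<in> sets M" by measurable
  have "s \<in> I" using mem_is_interval_1_I[OF interval_I I(1,2), of s] I s by auto
  moreover have "h ?B s = 0"
    by (rule unique_continuation_right[OF loewner_m I h_bound[OF B] _ s]) (auto intro!: h_eq_0I)
  ultimately have "AE \<omega> in M. \<not> (\<omega> \<in> ?B \<and> y \<omega> < s \<and> s < x \<omega>)" by (rule h_eq_0D[OF B])
  then show ?thesis using AE_space by eventually_elim auto
qed

lemma no_right_endpoint_aux:
  assumes I: "a \<in> I" "b \<in> I" "a < p" "p < b" and s: "s < p" "p - min (p - a) (b - p) < s"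
  shows "AE \<omega> in M. \<not> (x \<omega> \<le> p \<and> y \<omega> < s \<and> s < x \<omega>)"
proof -
  let ?B = "{\<omega> \<in> space M. x \<omega> \<le> p}"
  have B: "?B \<in> sets M" by measurable
  have "s \<in> I" using mem_is_interval_1_I[OF interval_I I(1,2), of s] I s by auto
  moreover have "h ?B s = 0"
    by (rule unique_continuation_left[OF loewner_m I h_bound[OF B] _ s]) (auto intro!: h_eq_0I)
  ultimately have "AE \<omega> in M. \<not> (\<omega> \<in> ?B \<and> y \<omega> < s \<and> s < x \<omega>)" by (rule h_eq_0D[OF B])
  then show ?thesis using AE_space by eventually_elim auto
qed

text \<open>Supplies rational parameters for \<open>no_left_endpoint_aux\<close>, so that countably
  many null sets cover every state whose lower coordinate is \<open>z\<close> and whose upper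
  coordinate is \<open>w\<close>.\<close>

lemma rational_chain:
  assumes z: "z \<in> I" "z < w"
  obtains a b p s where "a \<in> \<rat>" "b \<in> \<rat>" "p \<in> \<rat>" "s \<in> \<rat>" "a \<in> I" "b \<in> I" "a < p" "p < b"
    "p \<le> z" "z < s" "s < w" "s < p + min (p - a) (b - p)"
proof -
  obtain e where "e > 0" "ball z e \<subseteq> I" using open_I z open_contains_ball by metis
  \<comment> \<open>With quarters of the radius, \<open>a\<close> and \<open>b\<close> are more than
    \<open>2 * \<eta>\<close> away from \<open>p\<close>, while \<open>s - p\<close> is less than
    \<open>2 * \<eta>\<close>.\<close>
  moreover define \<eta> where "\<eta> = e / 4"
  ultimately have e: "\<eta> > 0" "ball z (4 * \<eta>) \<subseteq> I" by auto
  obtain a where a: "a \<in> \<rat>" "z - 4 * \<eta> < a" "a < z - 3 * \<eta>"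
    using Rats_dense_in_real[of "z - 4 * \<eta>" "z - 3 * \<eta>"] e by auto
  obtain b where b: "b \<in> \<rat>" "z + 3 * \<eta> < b" "b < z + 4 * \<eta>"
    using Rats_dense_in_real[of "z + 3 * \<eta>" "z + 4 * \<eta>"] e by auto
  obtain p where p: "p \<in> \<rat>" "z - \<eta> < p" "p < z"
    using Rats_dense_in_real[of "z - \<eta>" z] e by auto
  obtain s where s: "s \<in> \<rat>" "z < s" "s < min w (z + \<eta>)"
    using Rats_dense_in_real[of z "min w (z + \<eta>)"] e z by auto
  have "a \<in> ball z (4 * \<eta>)" "b \<in> ball z (4 * \<eta>)" using a b e by (auto simp: dist_real_def)
  then show ?thesis using a b p s e by (intro that[of a b p s]) auto
qed

lemma rational_chain':
  assumes z: "z \<in> I" "w < z"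
  obtains a b p s where "a \<in> \<rat>" "b \<in> \<rat>" "p \<in> \<rat>" "s \<in> \<rat>" "a \<in> I" "b \<in> I" "a < p" "p < b"
    "z \<le> p" "s < z" "w < s" "p - min (p - a) (b - p) < s"
proof -
  obtain e where "e > 0" "ball z e \<subseteq> I" using open_I z open_contains_ball by metis
  moreover define \<eta> where "\<eta> = e / 4"
  ultimately have e: "\<eta> > 0" "ball z (4 * \<eta>) \<subseteq> I" by auto
  obtain a where a: "a \<in> \<rat>" "z - 4 * \<eta> < a" "a < z - 3 * \<eta>"
    using Rats_dense_in_real[of "z - 4 * \<eta>" "z - 3 * \<eta>"] e by auto
  obtain b where b: "b \<in> \<rat>" "z + 3 * \<eta> < b" "b < z + 4 * \<eta>"
    using Rats_dense_in_real[of "z + 3 * \<eta>" "z + 4 * \<eta>"] e by auto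
  obtain p where p: "p \<in> \<rat>" "z < p" "p < z + \<eta>"
    using Rats_dense_in_real[of z "z + \<eta>"] e by auto
  obtain s where s: "s \<in> \<rat>" "max w (z - \<eta>) < s" "s < z"
    using Rats_dense_in_real[of "max w (z - \<eta>)" z] e z by auto
  have "a \<in> ball z (4 * \<eta>)" "b \<in> ball z (4 * \<eta>)" using a b e by (auto simp: dist_real_def)
  then show ?thesis using a b p s e by (intro that[of a b p s]) auto
qed

lemma no_left_endpoint: "AE \<omega> in M. y \<omega> < x \<omega> \<longrightarrow> y \<omega> \<notin> I"
proof -
  have "AE \<omega> in M. \<forall>a\<in>\<rat>. \<forall>b\<in>\<rat>. \<forall>p\<in>\<rat>. \<forall>s\<in>\<rat>. a \<in> I \<and> b \<in> I \<and> a < p \<and> p < b \<and> p < s \<and> s < p + min (p - a) (b - p) \<longrightarrow>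
      \<not> (p \<le> y \<omega> \<and> y \<omega> < s \<and> s < x \<omega>)"
    by (intro AE_ball_countable' countable_rat) (use no_left_endpoint_aux in auto)
  then show ?thesis
  proof eventually_elim
    case (elim \<omega>)
    show ?case
    proof (intro impI notI)
      assume "y \<omega> < x \<omega>" "y \<omega> \<in> I"
      then obtain a b p s where "a \<in> \<rat>" "b \<in> \<rat>" "p \<in> \<rat>" "s \<in> \<rat>" "a \<in> I" "b \<in> I" "a < p" "p < b"
        "p \<le> y \<omega>" "y \<omega> < s" "s < x \<omega>" "s < p + min (p - a) (b - p)"
        using rational_chain by metis
      then show False using elim by (meson le_less_trans)
    qed
  qed
qed

lemma no_right_endpoint: "AE \<omega> in M. y \<omega> < x \<omega> \<longrightarrow> x \<omega> \<notin> I"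
proof -
  have "AE \<omega> in M. \<forall>a\<in>\<rat>. \<forall>b\<in>\<rat>. \<forall>p\<in>\<rat>. \<forall>s\<in>\<rat>. a \<in> I \<and> b \<in> I \<and> a < p \<and> p < b \<and> s < p \<and> p - min (p - a) (b - p) < s \<longrightarrow>
      \<not> (x \<omega> \<le> p \<and> y \<omega> < s \<and> s < x \<omega>)"
    by (intro AE_ball_countable' countable_rat) (use no_right_endpoint_aux in auto)
  then show ?thesis
  proof eventually_elim
    case (elim \<omega>)
    show ?case
    proof (intro impI notI)
      assume "y \<omega> < x \<omega>" "x \<omega> \<in> I"
      then obtain a b p s where "a \<in> \<rat>" "b \<in> \<rat>" "p \<in> \<rat>" "s \<in> \<rat>" "a \<in> I" "b \<in> I" "a < p" "p < b"
        "x \<omega> \<le> p" "s < x \<omega>" "y \<omega> < s" "p - min (p - a) (b - p) < s"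
        using rational_chain' by metis
      then show False using elim by (meson less_le_trans)
    qed
  qed
qed

text \<open>Rational points of the state interval lie in \<open>I\<close>, and convexity fills in
  the others. A point of \<open>I\<close> beyond an end would, again by convexity, put that end into
  \<open>I\<close>.\<close>

lemma AE_interval_eq: "AE \<omega> in M. y \<omega> < x \<omega> \<longrightarrow> I = {y \<omega><..<x \<omega>}"
proof -
  have "AE \<omega> in M. \<forall>s\<in>\<rat>. s \<notin> I \<longrightarrow> \<not> (y \<omega> < s \<and> s < x \<omega>)"
    by (intro AE_ball_countable' countable_rat) (use not_in_I in auto)
  then show ?thesis
    using no_left_endpoint no_right_endpoint
  proof eventually_elim
    case (elim \<omega>)
    show ?case
    proof
      assume lt: "y \<omega> < x \<omega>"
      then have ends: "y \<omega> \<notin> I" "x \<omega> \<notin> I" using elim by auto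
      have sub: "z \<in> I" if z: "y \<omega> < z" "z < x \<omega>" for z
      proof -
        obtain s where s: "s \<in> \<rat>" "y \<omega> < s" "s < z" using Rats_dense_in_real[OF z(1)] by auto
        obtain t where t: "t \<in> \<rat>" "z < t" "t < x \<omega>" using Rats_dense_in_real[OF z(2)] by auto
        have "s \<in> I" "t \<in> I" using elim(1) s t z by (auto intro: ccontr)
        then show ?thesis using mem_is_interval_1_I[OF interval_I, of s t z] s t by auto
      qed
      define c where "c = (y \<omega> + x \<omega>) / 2"
      have c: "c \<in> I" "y \<omega> < c" "c < x \<omega>" using sub[of c] lt by (auto simp: c_def)
      have "y \<omega> < z \<and> z < x \<omega>" if "z \<in> I" for z
      proof (rule ccontr)
        assume "\<not> (y \<omega> < z \<and> z < x \<omega>)"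
        then consider "z \<le> y \<omega>" | "x \<omega> \<le> z" by linarith
        then show False
        proof cases
          case 1
          then show False using mem_is_interval_1_I[OF interval_I that c(1), of "y \<omega>"] ends c by auto
        next
          case 2
          then show False using mem_is_interval_1_I[OF interval_I c(1) that, of "x \<omega>"] ends c by auto
        qed
      qed
      then show "I = {y \<omega><..<x \<omega>}" using sub by auto
    qed
  qed
qed

theorem vacuum_or_dirac:
  "(AE \<omega> in M. x \<omega> = y \<omega>) \<or> (\<exists>a b. b < a \<and> (AE \<omega> in M. x \<omega> = a \<and> y \<omega> = b))"
proof (cases "AE \<omega> in M. x \<omega> = y \<omega>")
  case False
  obtain \<omega>0 where \<omega>0: "y \<omega>0 < x \<omega>0" "I = {y \<omega>0<..<x \<omega>0}"
  proof (rule ccontr)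
    assume "\<not> thesis"
    then have no: "\<not> (y \<omega> < x \<omega> \<and> I = {y \<omega><..<x \<omega>})" for \<omega> using that by blast
    have "AE \<omega> in M. x \<omega> = y \<omega>"
      using AE_interval_eq AE_space
    proof eventually_elim
      case (elim \<omega>)
      then show ?case using no[of \<omega>] y_le_x[of \<omega>] by fastforce
    qed
    then show False using False by simp
  qed
  define a b where "a = x \<omega>0" and "b = y \<omega>0"
  have ab: "b < a" "I = {b<..<a}" using \<omega>0 by (auto simp: a_def b_def)
  define A where "A = {\<omega> \<in> space M. y \<omega> < x \<omega>}"
  have A: "A \<in> sets M" unfolding A_def by measurable
  have AE_A: "AE \<omega> in M. \<omega> \<in> A \<longrightarrow> x \<omega> = a \<and> y \<omega> = b"
    using AE_interval_eq
  proof eventually_elim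
    case (elim \<omega>)
    show ?case
    proof
      assume "\<omega> \<in> A"
      then have lt: "y \<omega> < x \<omega>" by (simp add: A_def)
      then have "{y \<omega><..<x \<omega>} = {b<..<a}" using elim ab by simp
      then show "x \<omega> = a \<and> y \<omega> = b" using lt ab(1)
        by (metis cInf_greaterThanLessThan cSup_greaterThanLessThan)
    qed
  qed
  define \<kappa> where "\<kappa> = measure M A"
  define k0 where "k0 = (\<lambda>s. max ((a - s) * (s - b)) 0 powr l)"
  have k_eq: "AE \<omega> in M. k s \<omega> = indicator A \<omega> * k0 s" for s
    using AE_A AE_space
  proof eventually_elim
    case (elim \<omega>)
    show ?case
    proof (cases "\<omega> \<in> A")
      case True
      then show ?thesis using elim by (simp add: k_def k0_def)
    next
      case False
      then have "\<not> y \<omega> < x \<omega>" using elim(2) by (simp add: A_def)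
      then have "k s \<omega> = 0" using k_eq_0_iff[OF elim(2), of s] by linarith
      then show ?thesis using False by simp
    qed
  qed
  have fk: "f s = \<kappa> * k0 s" for s
  proof -
    have "f s = (\<integral>\<omega>. indicator A \<omega> * k0 s \<partial>M)"
      unfolding f_def by (intro integral_cong_AE k_eq) (use A in measurable)
    then show ?thesis using A by (simp add: \<kappa>_def)
  qed
  have Nk: "N s = (a + b) / 2 * f s" for s
  proof -
    have "N s = (\<integral>\<omega>. (a + b) / 2 * k s \<omega> \<partial>M)"
      unfolding N_def
    proof (intro integral_cong_AE)
      show "AE \<omega> in M. u \<omega> * k s \<omega> = (a + b) / 2 * k s \<omega>"
        using k_eq[of s] AE_A by eventually_elim (auto simp: u_def indicator_def)
    qed measurable
    then show ?thesis by (simp add: f_def)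
  qed
  have Ck: "C s t = \<kappa> * (k0 s * k0 t)" for s t
  proof -
    have "C s t = (\<integral>\<omega>. indicator A \<omega> * (k0 s * k0 t) \<partial>M)"
      unfolding C_def
    proof (intro integral_cong_AE)
      show "AE \<omega> in M. k s \<omega> * k t \<omega> = indicator A \<omega> * (k0 s * k0 t)"
        using k_eq[of s] k_eq[of t] by eventually_elim (auto simp: indicator_def)
    qed (use A in measurable)
    then show ?thesis using A by (simp add: \<kappa>_def)
  qed
  define s t where "s = (2 * b + a) / 3" and "t = (b + 2 * a) / 3"
  have st: "s < t" "s \<in> I" "t \<in> I" using ab by (auto simp: s_def t_def)
  have pos: "0 < \<kappa> * k0 s" "0 < \<kappa> * k0 t" using st fk by (auto simp: I_def)
  \<comment> \<open>The velocity is constant on \<open>A\<close>, so the terms with \<open>N\<close>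
    cancel in \<open>rel\<close>. What is left says that \<open>\<kappa>\<close> equals its square,
    and \<open>\<kappa>\<close> is not zero.\<close>
  have "(t - s) * (\<kappa> * (k0 s * k0 t)) = (t - s) * (\<kappa> * k0 s) * (\<kappa> * k0 t)"
    using rel[of t s] unfolding Ck Nk fk by (simp add: algebra_simps)
  then have "((t - s) * (\<kappa> * k0 s) * k0 t) * 1 = ((t - s) * (\<kappa> * k0 s) * k0 t) * \<kappa>"
    by (simp only: mult_ac mult_1_right)
  moreover have nz: "(t - s) * (\<kappa> * k0 s) * k0 t \<noteq> 0" using st(1) pos by auto
  ultimately have "\<kappa> = 1" unfolding mult_left_cancel[OF nz] by simp
  then have "AE \<omega> in M. \<omega> \<in> A" using A AE_prob_1 by (simp add: \<kappa>_def)
  then have "AE \<omega> in M. x \<omega> = a \<and> y \<omega> = b" using AE_A by eventually_elim auto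
  then show ?thesis using ab by blast
qed simp

end

section \<open>Transfer from the compactification\<close>

abbreviation "eval_space \<equiv> product_topology (\<lambda>_::real \<times> real \<Rightarrow> real. euclideanreal) barC"

lemma cpt_eq: "cpt = subtopology eval_space (eval_space closure_of (eval_pt ` H))"
  by (simp add: cpt_def Let_def)

lemma eval_pt_in_cpt: "eval_pt ` H \<subseteq> topspace cpt"
proof -
  have "eval_pt ` H \<subseteq> topspace eval_space" by (auto simp: eval_pt_def)
  then show ?thesis
    unfolding cpt_eq topspace_subtopology by (intro Int_greatest closure_of_subset)
qed

lemma topspace_state_space: "topspace state_space = eval_pt ` H \<union> vacuum"
proof -
  have "vacuum \<subseteq> topspace cpt" unfolding vacuum_def by (rule closure_of_subset_topspace)
  then show ?thesis
    unfolding state_space_def topspace_subtopology using eval_pt_in_cpt by (intro Int_absorb1 Un_least)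
qed

lemma Hausdorff_state_space: "Hausdorff_space state_space"
  unfolding state_space_def cpt_eq
  by (intro Hausdorff_space_subtopology) (simp add: Hausdorff_space_product_topology)

lemma continuous_map_coordinate:
  assumes "\<phi> \<in> barC"
  shows "continuous_map state_space euclideanreal (\<lambda>p. p \<phi>)"
  unfolding state_space_def cpt_eq
  by (intro continuous_map_from_subtopology continuous_map_product_projection assms)

text \<open>The bump at \<open>a\<close> belongs to \<open>barC\<close>, so its coordinate is
  continuous on the state space, and it exceeds \<open>1 - d / r\<close> only within distance
  \<open>d\<close> of \<open>a\<close>. Hence the Euclidean topology on \<open>H\<close> is
  recovered.\<close>

lemma openin_state_space_image:
  assumes "open U"
  shows "openin state_space (eval_pt ` (U \<inter> H))"
proof (subst openin_subopen, intro ballI)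
  fix q assume "q \<in> eval_pt ` (U \<inter> H)"
  then obtain a where a: "a \<in> U" "a \<in> H" "q = eval_pt a" by auto
  define r where "r = (fst a - snd a) / 2"
  have r: "0 < r" using a by (auto simp: H_def r_def)
  obtain e where e: "0 < e" "ball a e \<subseteq> U" using assms a open_contains_ball by metis
  define d where "d = min e r"
  have d: "0 < d" "d \<le> r" "ball a d \<subseteq> U" using e r by (auto simp: d_def)
  define \<phi> where "\<phi> = (\<lambda>z\<in>Hbar. max 0 (1 - dist z a / r))"
  have \<phi>: "\<phi> \<in> barC" using bump_in_barC[OF a(2)] by (simp add: \<phi>_def r_def)
  have val: "eval_pt b \<phi> = max 0 (1 - dist b a / r)" if "b \<in> Hbar" for b
    using that \<phi> by (simp add: eval_pt_def \<phi>_def)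
  have near: "dist b a < d" if "b \<in> Hbar" "1 - d / r < eval_pt b \<phi>" for b
  proof -
    have "d / r \<le> 1" using d r by simp
    then have "1 - d / r < 1 - dist b a / r" using that(2) unfolding val[OF that(1)] by linarith
    then have "dist b a / r < d / r" by linarith
    then show ?thesis using r divide_less_cancel[of "dist b a" r d] by linarith
  qed
  let ?V = "{p \<in> topspace state_space. p \<phi> \<in> {1 - d / r<..}}"
  have "openin state_space ?V"
    by (rule openin_continuous_map_preimage[OF continuous_map_coordinate[OF \<phi>]]) simp
  moreover have "q \<in> ?V"
  proof -
    have "a \<in> Hbar" using a by (auto simp: H_def Hbar_def)
    then show ?thesis using a r d by (auto simp: topspace_state_space val)
  qed
  moreover have "?V \<subseteq> eval_pt ` (U \<inter> H)"
  proof
    fix p assume p: "p \<in> ?V"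
    then consider b where "b \<in> H" "p = eval_pt b" | "p = eval_pt (0, 0)"
      by (auto simp: topspace_state_space vacuum_eq)
    then show "p \<in> eval_pt ` (U \<inter> H)"
    proof cases
      case 1
      then have "dist b a < d" using p by (intro near) (auto simp: H_def Hbar_def)
      then have "b \<in> U" using d by (auto simp: dist_commute)
      then show ?thesis using 1 by auto
    next
      case 2
      \<comment> \<open>Excludes the vacuum: every diagonal point is at distance at least
        \<open>r\<close> from \<open>a\<close>.\<close>
      have "dist (0, 0) a < d" using p 2 by (intro near) (auto simp: Hbar_def)
      then have "\<bar>fst a\<bar> < r" "\<bar>snd a\<bar> < r"
        using dist_fst_le[of "(0, 0)" a] dist_snd_le[of "(0, 0)" a] d by (auto simp: dist_real_def)
      then have "fst a - snd a < 2 * r" by linarith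
      then show ?thesis by (simp add: r_def)
    qed
  qed
  ultimately show "\<exists>T. openin state_space T \<and> q \<in> T \<and> T \<subseteq> eval_pt ` (U \<inter> H)"
    by (intro exI[of _ ?V] conjI)
qed

text \<open>The default is a diagonal point, so the formulas for the kernels give \<open>0\<close>
  on the vacuum, in agreement with \<open>on_states\<close>.\<close>

definition coords :: "cpt_point \<Rightarrow> real \<times> real" where
  "coords p = (if p \<in> eval_pt ` H then the_inv_into H eval_pt p else (0, 0))"

lemma coords_eval_pt: "a \<in> H \<Longrightarrow> coords (eval_pt a) = a"
  using inj_on_eval_pt by (simp add: coords_def the_inv_into_f_f)

lemma coords_in_H_iff: "coords p \<in> H \<longleftrightarrow> p \<in> eval_pt ` H"
proof
  assume "coords p \<in> H"
  then show "p \<in> eval_pt ` H" unfolding coords_def by (cases "p \<in> eval_pt ` H") (auto simp: H_def)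
qed (auto simp: coords_eval_pt)

lemma snd_coords_le: "snd (coords p) \<le> fst (coords p)"
proof (cases "p \<in> eval_pt ` H")
  case True
  then show ?thesis using coords_eval_pt by (auto simp: H_def)
qed (simp add: coords_def)

lemma eval_pt_coords: "coords p \<in> H \<Longrightarrow> eval_pt (coords p) = p"
  unfolding coords_in_H_iff using coords_eval_pt by auto

lemma on_states_eq: "F (0, 0) = 0 \<Longrightarrow> on_states F p = F (coords p)"
  by (simp add: on_states_def coords_def)

lemma openin_in_sets:
  assumes "sets \<nu> = sets (sigma (topspace state_space) {U. openin state_space U})" "openin state_space U"
  shows "U \<in> sets \<nu>"
  unfolding assms(1) using assms(2) openin_subset by (subst sets_measure_of) (auto intro!: sigma_sets.Basic)

text \<open>Continuity fails at the vacuum, which states near any diagonal point approach. Still,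
  the preimage of an open set is an open piece of \<open>H\<close>, possibly together with the whole
  vacuum.\<close>

lemma coords_measurable:
  assumes sets: "sets \<nu> = sets (sigma (topspace state_space) {U. openin state_space U})"
  shows "coords \<in> borel_measurable \<nu>"
proof (rule borel_measurableI)
  fix S :: "(real \<times> real) set" assume "open S"
  have space: "space \<nu> = topspace state_space" using sets_eq_imp_space_eq[OF sets] by (simp add: space_measure_of_conv)
  note opn = openin_in_sets[OF sets]
  have "eval_pt ` (S \<inter> H) \<in> sets \<nu>" by (rule opn[OF openin_state_space_image[OF \<open>open S\<close>]])
  moreover have "eval_pt ` H \<in> sets \<nu>" using opn[OF openin_state_space_image[OF open_UNIV]] by simp
  then have "(if (0, 0) \<in> S then space \<nu> - eval_pt ` H else {}) \<in> sets \<nu>" by auto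
  moreover have "coords -` S \<inter> space \<nu> = eval_pt ` (S \<inter> H) \<union> (if (0, 0) \<in> S then space \<nu> - eval_pt ` H else {})"
  proof (rule set_eqI)
    fix p
    show "p \<in> coords -` S \<inter> space \<nu> \<longleftrightarrow> p \<in> eval_pt ` (S \<inter> H) \<union> (if (0, 0) \<in> S then space \<nu> - eval_pt ` H else {})"
    proof (cases "p \<in> eval_pt ` H")
      case True
      then obtain a where a: "a \<in> H" "p = eval_pt a" by blast
      then have "p \<in> eval_pt ` (S \<inter> H) \<longleftrightarrow> a \<in> S"
        using inj_on_eval_pt by (auto simp: inj_on_def)
      moreover have "p \<in> space \<nu>" using True by (simp add: space topspace_state_space)
      ultimately show ?thesis using True a(1) coords_eval_pt[OF a(1)] unfolding a(2) by simp
    next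
      case False
      then have "p \<notin> eval_pt ` (S \<inter> H)" "coords p = (0, 0)" by (auto simp: coords_def)
      then show ?thesis using False by simp
    qed
  qed
  ultimately show "coords -` S \<inter> space \<nu> \<in> sets \<nu>" by auto
qed

lemma powr_le_1_plus:
  fixes r :: real
  assumes "0 \<le> r" "0 < e" "e \<le> q"
  shows "r powr e \<le> 1 + r powr q"
proof (cases "r \<le> 1")
  case True
  then have "r powr e \<le> 1" using assms by (intro powr_le1) auto
  then show ?thesis using powr_ge_zero[of r q] by linarith
next
  case False
  then have "r powr e \<le> r powr q" using assms by (intro powr_mono) auto
  then show ?thesis by simp
qed

section \<open>The kinetic setting of an entropy admissible measure\<close>

context
  fixes \<gamma> :: real and \<nu> :: "cpt_point measure"
  assumes \<gamma>: "1 < \<gamma>" "\<gamma> < 3" and adm: "entropy_admissible \<gamma> \<nu>"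
begin

abbreviation "cx p \<equiv> fst (coords p)"
abbreviation "cy p \<equiv> snd (coords p)"

lemma sets_nu: "sets \<nu> = sets (sigma (topspace state_space) {U. openin state_space U})"
  using adm by (simp add: entropy_admissible_def)

lemma space_nu: "space \<nu> = topspace state_space"
  using sets_eq_imp_space_eq[OF sets_nu] by (simp add: space_measure_of_conv)

lemma W_eq: "W \<gamma> p = 1 + ((cx p - cy p) / 2) powr ((\<gamma> + 1) / theta \<gamma>)"
  unfolding W_def rho_def by (subst on_states_eq) (auto simp: case_prod_beta powr_powr)

lemma coords_borel [measurable]: "coords \<in> borel_measurable \<nu>"
  by (rule coords_measurable[OF sets_nu])

lemma cx_cy_borel [measurable]: "cx \<in> borel_measurable \<nu>" "cy \<in> borel_measurable \<nu>"
  by (auto intro!: measurable_compose[OF coords_borel] borel_measurable_continuous_onI continuous_intros)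

text \<open>Multiplied by \<open>\<gamma> - 1\<close>, the exponents
  \<open>2 * lam \<gamma>\<close>, \<open>4 * lam \<gamma>\<close> and
  \<open>2 * lam \<gamma> + 1\<close> become \<open>3 - \<gamma>\<close>,
  \<open>6 - 2 * \<gamma>\<close> and \<open>2\<close>, all at most
  \<open>2 * (\<gamma> + 1)\<close>, the value for \<open>W\<close>. The summand \<open>1\<close> of
  \<open>W\<close> takes care of half-widths below one.\<close>

lemma kinetic_nu: "kinetic \<nu> cx cy (W \<gamma>) (lam \<gamma>) (theta \<gamma>)"
proof -
  interpret prob_space \<nu> using adm by (simp add: entropy_admissible_def)
  show ?thesis
  proof
    show "integrable \<nu> (W \<gamma>)"
    proof (rule integrableI_nonneg)
      show "W \<gamma> \<in> borel_measurable \<nu>"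
        unfolding W_eq[abs_def] by measurable
      show "AE p in \<nu>. 0 \<le> W \<gamma> p" by (simp add: W_eq)
      show "(\<integral>\<^sup>+ p. ennreal (W \<gamma> p) \<partial>\<nu>) < \<infinity>" using adm by (simp add: entropy_admissible_def)
    qed
    show "0 < lam \<gamma>" "theta \<gamma> * (2 * lam \<gamma> + 1) = 1"
      using \<gamma> by (auto simp: lam_def theta_def field_simps)
    have q: "(\<gamma> + 1) / theta \<gamma> = 2 * (\<gamma> + 1) / (\<gamma> - 1)" by (simp add: theta_def)
    have le: "((cx p - cy p) / 2) powr e \<le> W \<gamma> p" if "0 < e" "e * (\<gamma> - 1) \<le> 2 * (\<gamma> + 1)" for e p
      unfolding W_eq using that \<gamma> snd_coords_le[of p]
      by (intro powr_le_1_plus) (auto simp: q pos_le_divide_eq)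
    have lam: "lam \<gamma> * (\<gamma> - 1) = (3 - \<gamma>) / 2" "0 < lam \<gamma>" using \<gamma> by (auto simp: lam_def field_simps)
    show "((cx p - cy p) / 2) powr (2 * lam \<gamma>) \<le> W \<gamma> p" for p
      using \<gamma> lam(2) by (intro le) (simp_all add: mult.assoc lam(1))
    show "((cx p - cy p) / 2) powr (4 * lam \<gamma>) \<le> W \<gamma> p" for p
      using \<gamma> lam(2) by (intro le) (simp_all add: mult.assoc lam(1))
    show "((cx p - cy p) / 2) powr (2 * lam \<gamma> + 1) \<le> W \<gamma> p" for p
      using \<gamma> lam(2) by (intro le) (simp_all add: mult.assoc distrib_right lam(1))
  qed (auto simp: snd_coords_le)
qed

lemma admissible_nu: "admissible \<nu> cx cy (W \<gamma>) (lam \<gamma>) (theta \<gamma>)"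
proof -
  interpret kinetic \<nu> cx cy "W \<gamma>" "lam \<gamma>" "theta \<gamma>" by (rule kinetic_nu)
  have chi: "chi \<gamma> s = k s" for s
    unfolding chi_def by (intro ext, subst on_states_eq) (auto simp: k_def case_prod_beta not_less)
  have sigma: "sigma_kernel \<gamma> s = (\<lambda>p. (theta \<gamma> * s + (1 - theta \<gamma>) * u p) * k s p)" for s
    unfolding sigma_kernel_def by (intro ext, subst on_states_eq) (auto simp: k_def u_def case_prod_beta not_less)
  show ?thesis
    by unfold_locales (use adm in \<open>simp add: entropy_admissible_def chi sigma\<close>)
qed

end

lemma measure_support_subset:
  assumes "openin X U" "emeasure \<nu> U = 0"
  shows "measure_support X \<nu> \<subseteq> topspace X - U"
  using assms by (auto simp: measure_support_def)

theorem theorem3p2: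
  fixes \<gamma> :: real and \<nu> :: "cpt_point measure"
  assumes "1 < \<gamma>" and "\<gamma> \<le> 5 / 3"
    and "entropy_admissible \<gamma> \<nu>"
  shows "(\<exists>a\<in>H. measure_support state_space \<nu> = {eval_pt a})
       \<or> measure_support state_space \<nu> \<subseteq> vacuum"
proof -
  have \<gamma>: "1 < \<gamma>" "\<gamma> < 3" using assms by auto
  note sets = sets_nu[OF \<gamma> assms(3)] and space = space_nu[OF \<gamma> assms(3)]
  interpret admissible \<nu> "\<lambda>p. fst (coords p)" "\<lambda>p. snd (coords p)" "W \<gamma>" "lam \<gamma>" "theta \<gamma>"
    by (rule admissible_nu[OF \<gamma> assms(3)])
  consider "AE p in \<nu>. fst (coords p) = snd (coords p)"
    | a b where "b < a" "AE p in \<nu>. fst (coords p) = a \<and> snd (coords p) = b"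
    using vacuum_or_dirac by blast
  then show ?thesis
  proof cases
    case 1
    have opn: "openin state_space (eval_pt ` H)"
      using openin_state_space_image[OF open_UNIV] by simp
    then have "eval_pt ` H \<in> sets \<nu>" by (rule openin_in_sets[OF sets])
    moreover have "AE p in \<nu>. p \<notin> eval_pt ` H"
      using 1 unfolding coords_in_H_iff[symmetric] by eventually_elim (auto simp: H_def)
    ultimately have "emeasure \<nu> (eval_pt ` H) = 0" using AE_iff_null_sets by blast
    then have "measure_support state_space \<nu> \<subseteq> vacuum"
      using measure_support_subset[OF opn] by (auto simp: topspace_state_space)
    then show ?thesis ..
  next
    case 2
    then have H: "(a, b) \<in> H" by (simp add: H_def)
    define q where "q = eval_pt (a, b)"
    have AE_q: "AE p in \<nu>. p = q"
      using 2(2)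
    proof eventually_elim
      case (elim p)
      then have "coords p = (a, b)" by (simp add: prod_eq_iff)
      then show ?case using eval_pt_coords[of p] H by (simp add: q_def)
    qed
    have q: "q \<in> topspace state_space" using H by (auto simp: topspace_state_space q_def)
    \<comment> \<open>Almost every state being \<open>q\<close> bounds the support only once the
      complement of \<open>q\<close> is known to be open; this is where the Hausdorff property
      enters.\<close>
    then have "closedin state_space {q}" by (simp add: Hausdorff_state_space closedin_Hausdorff_singleton)
    then have opn: "openin state_space (topspace state_space - {q})" by (simp add: openin_diff)
    have "emeasure \<nu> (topspace state_space - {q}) = 0"
    proof -
      have "AE p in \<nu>. p \<notin> topspace state_space - {q}" using AE_q by eventually_elim simp
      then show ?thesis using AE_iff_null_sets[OF openin_in_sets[OF sets opn]] by blast
    qed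
    then have "measure_support state_space \<nu> \<subseteq> {q}"
      using measure_support_subset[OF opn] by auto
    moreover have "q \<in> measure_support state_space \<nu>"
      unfolding measure_support_def
    proof (intro CollectI conjI allI impI q)
      fix U assume U: "openin state_space U \<and> q \<in> U"
      then have "AE p in \<nu>. p \<in> U" using AE_q by auto
      then have "emeasure \<nu> U = 1"
        using openin_in_sets[OF sets] U by (intro emeasure_eq_1_AE) auto
      then show "0 < emeasure \<nu> U" by simp
    qed
    ultimately have "measure_support state_space \<nu> = {eval_pt (a, b)}" by (auto simp: q_def)
    then show ?thesis using H by blast
  qed
qed

end
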